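(* Let $(\mathfrak g,\alpha_{\mathfrak g})$ be any Hom-Leibniz algebra over a field $\mathbb K$, and let $\lambda_{\mathfrak g}:\mathfrak g\curlywedge\mathfrak g\to\mathfrak g$, $x\curlywedge y\mapsto[x,y]$, be the commutator map from the exterior product. Then there is an isomorphism of Hom-vector spaces $$HL_2^{\alpha}(\mathfrak g)\cong(\ker(\lambda_{\mathfrak g}),\alpha_{\ker(\lambda_{\mathfrak g})}),$$ where $\alpha_{\ker(\lambda_{\mathfrak g})}$ is the restriction of $\alpha_{\mathfrak g\curlywedge\mathfrak g}$.
   Context: All vector spaces and linear maps are over a fixed field $\mathbb K$. A (multiplicative) Hom-Leibniz algebra $(\mathfrak g,\alpha_{\mathfrak g})$ is a vector space $\mathfrak g$ with a bilinear product $[\,,]$ and a linear map $\alpha_{\mathfrak g}:\mathfrak g\to\mathfrak g$ such that $[\alpha_{\mathfrak g}(x),[y,z]]=[[x,y],\alpha_{\mathfrak g}(z)]-[[x,z],\alpha_{\mathfrak g}(y)]$ and $\alpha_{\mathfrak g}([x,y])=[\alpha_{\mathfrak g}(x),\alpha_{\mathfrak g}(y)]$ for all $x,y,z$. A Hom-vector space is a vector space with a linear self-map; homomorphisms (of Hom-vector spaces or Hom-Leibniz algebras) are linear maps (preserving products, in the algebra case) commuting with the self-maps. Exterior product: $(\mathfrak g\curlywedge\mathfrak g,\alpha_{\mathfrak g\curlywedge\mathfrak g})$ is the Hom-Leibniz algebra generated by symbols $x\curlywedge y$ ($x,y\in\mathfrak g$), bilinear in $(x,y)$, subject to, for all $x,y,z,x',y'\in\mathfrak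 g$: $\alpha_{\mathfrak g}(x)\curlywedge[y,z]=-\alpha_{\mathfrak g}(x)\curlywedge[z,y]$; $\alpha_{\mathfrak g}(x)\curlywedge[y,z]=[x,y]\curlywedge\alpha_{\mathfrak g}(z)-[x,z]\curlywedge\alpha_{\mathfrak g}(y)$; $[x,y]\curlywedge\alpha_{\mathfrak g}(z)=[x,z]\curlywedge\alpha_{\mathfrak g}(y)-\alpha_{\mathfrak g}(x)\curlywedge[z,y]$; $[x\curlywedge y,x'\curlywedge y']=[x,y]\curlywedge[x',y']$; with $\alpha_{\mathfrak g\curlywedge\mathfrak g}(x\curlywedge y)=\alpha_{\mathfrak g}(x)\curlywedge\alpha_{\mathfrak g}(y)$. Homology: let $CL_n^\alpha(\mathfrak g)=(\mathfrak g^{\otimes n},\alpha_{\mathfrak g}^{\otimes n})$ with $$d_n(x_1\otimes\dots\otimes x_n)=\sum_{1\le i<j\le n}(-1)^{j+1}\alpha_{\mathfrak g}(x_1)\otimes\dots\otimes\alpha_{\mathfrak g}(x_{i-1})\otimes[x_i,x_j]\otimes\alpha_{\mathfrak g}(x_{i+1})\otimes\dots\otimes\widehat{\alpha_{\mathfrak g}(x_j)}\otimes\dots\otimes\alpha_{\mathfrak g}(x_n)$$ (hat means omitted). Then $HL_n^\alpha(\mathfrak g)=\ker(d_n)/\mathrm{Im}(d_{n+1})$, a Hom-vector space with the self-map induced by $\alpha_{\mathfrak g}^{\otimes n}$. *)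

theory Defs
  imports "HOL.Hull" "HOL-Algebra.Module" "HOL-Algebra.QuotRing"
begin

section \<open>Hom-vector spaces and Hom-Leibniz algebras\<close>

text \<open>A vector space is a \<open>module\<close> over a \<open>field\<close>; the record is extended by
  the self-map.  The bracket \<open>[x, y]\<close> of a Hom-Leibniz algebra is the field \<open>mult\<close>, written
  \<open>x \<otimes> y\<close>.  The field \<open>one\<close> is never used, and neither is \<open>mult\<close> for spaces without a bracket.\<close>

record ('k, 'a) hom_module = "('k, 'a) module" +
  twist :: "'a \<Rightarrow> 'a"

locale hom_vector_space = K?: field K + V?: module K V
  for K :: "('k, 'r) ring_scheme" (structure) and V :: "('k, 'a, 'm) hom_module_scheme" (structure) +
  assumes twist_closed: "x \<in> carrier V \<Longrightarrow> twist V x \<in> carrier V"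
    and twist_add: "\<lbrakk>x \<in> carrier V; y \<in> carrier V\<rbrakk>
      \<Longrightarrow> twist V (x \<oplus>\<^bsub>V\<^esub> y) = twist V x \<oplus>\<^bsub>V\<^esub> twist V y"
    and twist_smult: "\<lbrakk>c \<in> carrier K; x \<in> carrier V\<rbrakk>
      \<Longrightarrow> twist V (c \<odot>\<^bsub>V\<^esub> x) = c \<odot>\<^bsub>V\<^esub> twist V x"

locale hom_leibniz_algebra = hom_vector_space K G
  for K :: "('k, 'r) ring_scheme" (structure) and G :: "('k, 'a, 'm) hom_module_scheme" (structure) +
  assumes bracket_closed: "\<lbrakk>x \<in> carrier G; y \<in> carrier G\<rbrakk> \<Longrightarrow> x \<otimes>\<^bsub>G\<^esub> y \<in> carrier G"
    and bracket_add_left: "\<lbrakk>x \<in> carrier G; y \<in> carrier G; z \<in> carrier G\<rbrakk>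
      \<Longrightarrow> (x \<oplus>\<^bsub>G\<^esub> y) \<otimes>\<^bsub>G\<^esub> z = x \<otimes>\<^bsub>G\<^esub> z \<oplus>\<^bsub>G\<^esub> y \<otimes>\<^bsub>G\<^esub> z"
    and bracket_add_right: "\<lbrakk>x \<in> carrier G; y \<in> carrier G; z \<in> carrier G\<rbrakk>
      \<Longrightarrow> x \<otimes>\<^bsub>G\<^esub> (y \<oplus>\<^bsub>G\<^esub> z) = x \<otimes>\<^bsub>G\<^esub> y \<oplus>\<^bsub>G\<^esub> x \<otimes>\<^bsub>G\<^esub> z"
    and bracket_smult_left: "\<lbrakk>c \<in> carrier K; x \<in> carrier G; y \<in> carrier G\<rbrakk>
      \<Longrightarrow> (c \<odot>\<^bsub>G\<^esub> x) \<otimes>\<^bsub>G\<^esub> y = c \<odot>\<^bsub>G\<^esub> (x \<otimes>\<^bsub>G\<^esub> y)"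
    and bracket_smult_right: "\<lbrakk>c \<in> carrier K; x \<in> carrier G; y \<in> carrier G\<rbrakk>
      \<Longrightarrow> x \<otimes>\<^bsub>G\<^esub> (c \<odot>\<^bsub>G\<^esub> y) = c \<odot>\<^bsub>G\<^esub> (x \<otimes>\<^bsub>G\<^esub> y)"
    and hom_leibniz: "\<lbrakk>x \<in> carrier G; y \<in> carrier G; z \<in> carrier G\<rbrakk>
      \<Longrightarrow> twist G x \<otimes>\<^bsub>G\<^esub> (y \<otimes>\<^bsub>G\<^esub> z)
          = (x \<otimes>\<^bsub>G\<^esub> y) \<otimes>\<^bsub>G\<^esub> twist G z \<ominus>\<^bsub>G\<^esub> (x \<otimes>\<^bsub>G\<^esub> z) \<otimes>\<^bsub>G\<^esub> twist G y"
    and twist_bracket: "\<lbrakk>x \<in> carrier G; y \<in> carrier G\<rbrakk>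
      \<Longrightarrow> twist G (x \<otimes>\<^bsub>G\<^esub> y) = twist G x \<otimes>\<^bsub>G\<^esub> twist G y"

definition hom_vs_hom ::
  "('k, 'r) ring_scheme \<Rightarrow> ('k, 'a, 'm) hom_module_scheme \<Rightarrow> ('k, 'b, 'n) hom_module_scheme
    \<Rightarrow> ('a \<Rightarrow> 'b) set"
  where "hom_vs_hom K V W =
    {f. f \<in> carrier V \<rightarrow> carrier W
      \<and> (\<forall>x\<in>carrier V. \<forall>y\<in>carrier V. f (x \<oplus>\<^bsub>V\<^esub> y) = f x \<oplus>\<^bsub>W\<^esub> f y)
      \<and> (\<forall>c\<in>carrier K. \<forall>x\<in>carrier V. f (c \<odot>\<^bsub>V\<^esub> x) = c \<odot>\<^bsub>W\<^esub> f x)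
      \<and> (\<forall>x\<in>carrier V. f (twist V x) = twist W (f x))}"

definition hom_vs_isomorphic ::
  "('k, 'r) ring_scheme \<Rightarrow> ('k, 'a, 'm) hom_module_scheme \<Rightarrow> ('k, 'b, 'n) hom_module_scheme
    \<Rightarrow> bool"
  where "hom_vs_isomorphic K V W \<longleftrightarrow>
    hom_vector_space K V \<and> hom_vector_space K W
    \<and> (\<exists>f \<in> hom_vs_hom K V W. bij_betw f (carrier V) (carrier W))"

definition hom_vs_ker ::
  "('k, 'a) hom_module \<Rightarrow> ('b, 'n) ring_scheme \<Rightarrow> ('a \<Rightarrow> 'b) \<Rightarrow> ('k, 'a) hom_module"
  where "hom_vs_ker V W f = V\<lparr>carrier := a_kernel V W f\<rparr>"

text \<open>\<open>quot_map W N f\<close> is the map sending a coset \<open>x + M\<close> to \<open>f x + N\<close>; it is meaningful for linear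
  \<open>f\<close> with \<open>f ` M \<subseteq> N\<close>.\<close>

definition quot_map :: "('b, 'n) ring_scheme \<Rightarrow> 'b set \<Rightarrow> ('a \<Rightarrow> 'b) \<Rightarrow> 'a set \<Rightarrow> 'b set"
  where "quot_map W N f X = (\<Union>x\<in>X. N +>\<^bsub>W\<^esub> f x)"

definition quot_hom_module :: "('k, 'a) hom_module \<Rightarrow> 'a set \<Rightarrow> ('k, 'a set) hom_module"
  where "quot_hom_module V N =
    \<lparr>carrier = a_rcosets\<^bsub>V\<^esub> N, mult = rcoset_mult V N, one = undefined,
     zero = N, add = set_add V,
     smult = (\<lambda>c. quot_map V N (\<lambda>x. c \<odot>\<^bsub>V\<^esub> x)),
     twist = quot_map V N (twist V)\<rparr>"

section \<open>Free vector spaces\<close>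

definition basis_vec :: "('k, 'r) ring_scheme \<Rightarrow> 'b \<Rightarrow> 'b \<Rightarrow> 'k"
  where "basis_vec K b = (\<lambda>b'. if b' = b then \<one>\<^bsub>K\<^esub> else \<zero>\<^bsub>K\<^esub>)"

text \<open>The finitely supported \<open>K\<close>-valued functions on \<open>B\<close>, extended by \<open>\<zero>\<close> outside \<open>B\<close>.\<close>

definition free_vs :: "('k, 'r) ring_scheme \<Rightarrow> 'b set \<Rightarrow> ('k, 'b \<Rightarrow> 'k) module"
  where "free_vs K B =
    \<lparr>carrier = {f. (\<forall>b\<in>B. f b \<in> carrier K) \<and> (\<forall>b. b \<notin> B \<longrightarrow> f b = \<zero>\<^bsub>K\<^esub>)
                  \<and> finite {b. f b \<noteq> \<zero>\<^bsub>K\<^esub>}},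
     mult = undefined, one = undefined,
     zero = (\<lambda>_. \<zero>\<^bsub>K\<^esub>), add = (\<lambda>f g b. f b \<oplus>\<^bsub>K\<^esub> g b),
     smult = (\<lambda>c f b. c \<otimes>\<^bsub>K\<^esub> f b)\<rparr>"

definition lin_ext ::
  "('k, 'r) ring_scheme \<Rightarrow> ('k, 'a, 'm) module_scheme \<Rightarrow> ('b \<Rightarrow> 'a) \<Rightarrow> ('b \<Rightarrow> 'k) \<Rightarrow> 'a"
  where "lin_ext K W h f = (\<Oplus>\<^bsub>W\<^esub> b\<in>{b. f b \<noteq> \<zero>\<^bsub>K\<^esub>}. f b \<odot>\<^bsub>W\<^esub> h b)"

section \<open>Tensor powers and homology\<close>

text \<open>The pure tensor \<open>x\<^sub>1 \<otimes> \<dots> \<otimes> x\<^sub>n\<close> is the class of the list \<open>[x\<^sub>1, \<dots>, x\<^sub>n]\<close>.\<close>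

definition tensor_gens :: "('a, 'm) ring_scheme \<Rightarrow> nat \<Rightarrow> 'a list set"
  where "tensor_gens G n = {xs. set xs \<subseteq> carrier G \<and> length xs = n}"

definition free_tensor ::
  "('k, 'r) ring_scheme \<Rightarrow> ('k, 'a) hom_module \<Rightarrow> nat \<Rightarrow> ('k, 'a list \<Rightarrow> 'k) hom_module"
  where "free_tensor K G n = module.extend (free_vs K (tensor_gens G n))
    \<lparr>twist = lin_ext K (free_vs K (tensor_gens G n)) (\<lambda>xs. basis_vec K (map (twist G) xs))\<rparr>"

inductive_set multilin_rels ::
  "('k, 'r) ring_scheme \<Rightarrow> ('k, 'a) hom_module \<Rightarrow> nat \<Rightarrow> ('a list \<Rightarrow> 'k) set"
  for K :: "('k, 'r) ring_scheme" and G :: "('k, 'a) hom_module" and n :: nat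
  where
  add: "\<lbrakk>us @ [x] @ vs \<in> tensor_gens G n; us @ [y] @ vs \<in> tensor_gens G n\<rbrakk>
    \<Longrightarrow> basis_vec K (us @ [x \<oplus>\<^bsub>G\<^esub> y] @ vs)
        \<ominus>\<^bsub>free_tensor K G n\<^esub> (basis_vec K (us @ [x] @ vs)
          \<oplus>\<^bsub>free_tensor K G n\<^esub> basis_vec K (us @ [y] @ vs)) \<in> multilin_rels K G n"
| smult: "\<lbrakk>us @ [x] @ vs \<in> tensor_gens G n; c \<in> carrier K\<rbrakk>
    \<Longrightarrow> basis_vec K (us @ [c \<odot>\<^bsub>G\<^esub> x] @ vs)
        \<ominus>\<^bsub>free_tensor K G n\<^esub> (c \<odot>\<^bsub>free_tensor K G n\<^esub> basis_vec K (us @ [x] @ vs))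
      \<in> multilin_rels K G n"

definition tensor_ker ::
  "('k, 'r) ring_scheme \<Rightarrow> ('k, 'a) hom_module \<Rightarrow> nat \<Rightarrow> ('a list \<Rightarrow> 'k) set"
  where "tensor_ker K G n = (\<lambda>N. submodule N K (free_tensor K G n)) hull multilin_rels K G n"

definition CL ::
  "('k, 'r) ring_scheme \<Rightarrow> ('k, 'a) hom_module \<Rightarrow> nat \<Rightarrow> ('k, ('a list \<Rightarrow> 'k) set) hom_module"
  where "CL K G n = quot_hom_module (free_tensor K G n) (tensor_ker K G n)"

text \<open>The summand of \<open>d\<^sub>n(x\<^sub>1 \<otimes> \<dots> \<otimes> x\<^sub>n)\<close> for \<open>1 \<le> i < j \<le> n\<close>, without its sign.  List positions
  count from \<open>0\<close>, so \<open>x\<^sub>k\<close> is \<open>xs ! (k - 1)\<close>.\<close>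

definition boundary_summand :: "('k, 'a) hom_module \<Rightarrow> 'a list \<Rightarrow> nat \<Rightarrow> nat \<Rightarrow> 'a list"
  where "boundary_summand G xs i j =
    (let x = (\<lambda>k. xs ! (k - 1)); \<alpha>x = (\<lambda>k. twist G (x k))
     in map \<alpha>x [1..<i] @ [x i \<otimes>\<^bsub>G\<^esub> x j] @ map \<alpha>x [i+1..<j] @ map \<alpha>x [j+1..<length xs + 1])"

definition boundary_gen ::
  "('k, 'r) ring_scheme \<Rightarrow> ('k, 'a) hom_module \<Rightarrow> nat \<Rightarrow> 'a list \<Rightarrow> ('a list \<Rightarrow> 'k)"
  where "boundary_gen K G n xs =
    finsum (free_tensor K G (n - 1))
      (\<lambda>(i, j). ((\<ominus>\<^bsub>K\<^esub> \<one>\<^bsub>K\<^esub>) [^]\<^bsub>K\<^esub> (j + 1))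
        \<odot>\<^bsub>free_tensor K G (n - 1)\<^esub> basis_vec K (boundary_summand G xs i j))
      {(i, j). 1 \<le> i \<and> i < j \<and> j \<le> n}"

text \<open>\<open>boundary K G n\<close> maps \<open>CL K G n\<close> to \<open>CL K G (n - 1)\<close>.  For \<open>n \<le> 1\<close> the sum is empty, so
  \<open>boundary K G n\<close> is the zero map; in particular the truncation \<open>0 - 1 = 0\<close> is harmless.\<close>

definition boundary ::
  "('k, 'r) ring_scheme \<Rightarrow> ('k, 'a) hom_module \<Rightarrow> nat
    \<Rightarrow> ('a list \<Rightarrow> 'k) set \<Rightarrow> ('a list \<Rightarrow> 'k) set"
  where "boundary K G n = quot_map (free_tensor K G (n - 1)) (tensor_ker K G (n - 1))
    (lin_ext K (free_tensor K G (n - 1)) (boundary_gen K G n))"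

definition HL ::
  "('k, 'r) ring_scheme \<Rightarrow> ('k, 'a) hom_module \<Rightarrow> nat
    \<Rightarrow> ('k, ('a list \<Rightarrow> 'k) set set) hom_module"
  where "HL K G n = quot_hom_module
    (hom_vs_ker (CL K G n) (CL K G (n - 1)) (boundary K G n))
    (boundary K G (n + 1) ` carrier (CL K G (n + 1)))"

section \<open>The exterior product\<close>

text \<open>The Hom-Leibniz algebra presented by generators and relations is the quotient of the free
  algebra with a bilinear bracket and a linear self-map on the symbols \<open>Wedge x y\<close> (whose basis
  consists of the terms below) by the ideal generated by the laws of a multiplicative Hom-Leibniz
  algebra and the given relations.\<close>

datatype 'a ext_term =
    Wedge 'a 'a
  | Brk "'a ext_term" "'a ext_term"
  | Twist "'a ext_term"

definition free_ext_alg ::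
  "('k, 'r) ring_scheme \<Rightarrow> ('k, 'a) hom_module \<Rightarrow> ('k, 'a ext_term \<Rightarrow> 'k) hom_module"
  where "free_ext_alg K G =
    (let F = free_vs K {t. set_ext_term t \<subseteq> carrier G}
     in module.extend
          (F\<lparr>mult := (\<lambda>f g. lin_ext K F (\<lambda>s. lin_ext K F (\<lambda>t. basis_vec K (Brk s t)) g) f)\<rparr>)
          \<lparr>twist = lin_ext K F (\<lambda>t. basis_vec K (Twist t))\<rparr>)"

abbreviation wedge_sym :: "('k, 'r) ring_scheme \<Rightarrow> 'a \<Rightarrow> 'a \<Rightarrow> ('a ext_term \<Rightarrow> 'k)"
  where "wedge_sym K x y \<equiv> basis_vec K (Wedge x y)"

text \<open>\<open>ext_rel K G l r\<close>: the relation \<open>l = r\<close> is imposed.\<close>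

inductive ext_rel ::
  "('k, 'r) ring_scheme \<Rightarrow> ('k, 'a) hom_module
    \<Rightarrow> ('a ext_term \<Rightarrow> 'k) \<Rightarrow> ('a ext_term \<Rightarrow> 'k) \<Rightarrow> bool"
  for K :: "('k, 'r) ring_scheme" and G :: "('k, 'a) hom_module"
  where
  leibniz: "\<lbrakk>A = free_ext_alg K G; u \<in> carrier A; v \<in> carrier A; w \<in> carrier A\<rbrakk>
    \<Longrightarrow> ext_rel K G (twist A u \<otimes>\<^bsub>A\<^esub> (v \<otimes>\<^bsub>A\<^esub> w))
          ((u \<otimes>\<^bsub>A\<^esub> v) \<otimes>\<^bsub>A\<^esub> twist A w \<ominus>\<^bsub>A\<^esub> (u \<otimes>\<^bsub>A\<^esub> w) \<otimes>\<^bsub>A\<^esub> twist A v)"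
| multiplicative: "\<lbrakk>A = free_ext_alg K G; u \<in> carrier A; v \<in> carrier A\<rbrakk>
    \<Longrightarrow> ext_rel K G (twist A (u \<otimes>\<^bsub>A\<^esub> v)) (twist A u \<otimes>\<^bsub>A\<^esub> twist A v)"
| add_left: "\<lbrakk>A = free_ext_alg K G; x \<in> carrier G; y \<in> carrier G; z \<in> carrier G\<rbrakk>
    \<Longrightarrow> ext_rel K G (wedge_sym K (x \<oplus>\<^bsub>G\<^esub> y) z) (wedge_sym K x z \<oplus>\<^bsub>A\<^esub> wedge_sym K y z)"
| add_right: "\<lbrakk>A = free_ext_alg K G; x \<in> carrier G; y \<in> carrier G; z \<in> carrier G\<rbrakk>
    \<Longrightarrow> ext_rel K G (wedge_sym K x (y \<oplus>\<^bsub>G\<^esub> z)) (wedge_sym K x y \<oplus>\<^bsub>A\<^esub> wedge_sym K x z)"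
| smult_left: "\<lbrakk>A = free_ext_alg K G; c \<in> carrier K; x \<in> carrier G; y \<in> carrier G\<rbrakk>
    \<Longrightarrow> ext_rel K G (wedge_sym K (c \<odot>\<^bsub>G\<^esub> x) y) (c \<odot>\<^bsub>A\<^esub> wedge_sym K x y)"
| smult_right: "\<lbrakk>A = free_ext_alg K G; c \<in> carrier K; x \<in> carrier G; y \<in> carrier G\<rbrakk>
    \<Longrightarrow> ext_rel K G (wedge_sym K x (c \<odot>\<^bsub>G\<^esub> y)) (c \<odot>\<^bsub>A\<^esub> wedge_sym K x y)"
| alternating: "\<lbrakk>A = free_ext_alg K G; x \<in> carrier G; y \<in> carrier G; z \<in> carrier G\<rbrakk>
    \<Longrightarrow> ext_rel K G (wedge_sym K (twist G x) (y \<otimes>\<^bsub>G\<^esub> z))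
          (\<ominus>\<^bsub>A\<^esub> wedge_sym K (twist G x) (z \<otimes>\<^bsub>G\<^esub> y))"
| wedge_bracket: "\<lbrakk>A = free_ext_alg K G; x \<in> carrier G; y \<in> carrier G; z \<in> carrier G\<rbrakk>
    \<Longrightarrow> ext_rel K G (wedge_sym K (twist G x) (y \<otimes>\<^bsub>G\<^esub> z))
          (wedge_sym K (x \<otimes>\<^bsub>G\<^esub> y) (twist G z) \<ominus>\<^bsub>A\<^esub> wedge_sym K (x \<otimes>\<^bsub>G\<^esub> z) (twist G y))"
| bracket_wedge: "\<lbrakk>A = free_ext_alg K G; x \<in> carrier G; y \<in> carrier G; z \<in> carrier G\<rbrakk>
    \<Longrightarrow> ext_rel K G (wedge_sym K (x \<otimes>\<^bsub>G\<^esub> y) (twist G z))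
          (wedge_sym K (x \<otimes>\<^bsub>G\<^esub> z) (twist G y) \<ominus>\<^bsub>A\<^esub> wedge_sym K (twist G x) (z \<otimes>\<^bsub>G\<^esub> y))"
| bracket: "\<lbrakk>A = free_ext_alg K G; x \<in> carrier G; y \<in> carrier G; x' \<in> carrier G; y' \<in> carrier G\<rbrakk>
    \<Longrightarrow> ext_rel K G (wedge_sym K x y \<otimes>\<^bsub>A\<^esub> wedge_sym K x' y')
          (wedge_sym K (x \<otimes>\<^bsub>G\<^esub> y) (x' \<otimes>\<^bsub>G\<^esub> y'))"
| twist_wedge: "\<lbrakk>A = free_ext_alg K G; x \<in> carrier G; y \<in> carrier G\<rbrakk>
    \<Longrightarrow> ext_rel K G (twist A (wedge_sym K x y)) (wedge_sym K (twist G x) (twist G y))"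

definition hom_ideal :: "('k, 'r) ring_scheme \<Rightarrow> ('k, 'a) hom_module \<Rightarrow> 'a set \<Rightarrow> bool"
  where "hom_ideal K A I \<longleftrightarrow> submodule I K A
    \<and> (\<forall>a\<in>carrier A. \<forall>u\<in>I. a \<otimes>\<^bsub>A\<^esub> u \<in> I \<and> u \<otimes>\<^bsub>A\<^esub> a \<in> I)
    \<and> (\<forall>u\<in>I. twist A u \<in> I)"

definition ext_ideal ::
  "('k, 'r) ring_scheme \<Rightarrow> ('k, 'a) hom_module \<Rightarrow> ('a ext_term \<Rightarrow> 'k) set"
  where "ext_ideal K G =
    hom_ideal K (free_ext_alg K G) hull {l \<ominus>\<^bsub>free_ext_alg K G\<^esub> r | l r. ext_rel K G l r}"

definition exterior_product ::
  "('k, 'r) ring_scheme \<Rightarrow> ('k, 'a) hom_module \<Rightarrow> ('k, ('a ext_term \<Rightarrow> 'k) set) hom_module"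
  where "exterior_product K G = quot_hom_module (free_ext_alg K G) (ext_ideal K G)"

text \<open>The commutator map is the homomorphism of Hom-Leibniz algebras with \<open>Wedge x y \<mapsto> [x, y]\<close>: its
  values on terms are forced, and the linear extension is constant on cosets of the ideal.\<close>

primrec commutator_term :: "('k, 'a) hom_module \<Rightarrow> 'a ext_term \<Rightarrow> 'a"
  where
  "commutator_term G (Wedge x y) = x \<otimes>\<^bsub>G\<^esub> y"
| "commutator_term G (Brk s t) = commutator_term G s \<otimes>\<^bsub>G\<^esub> commutator_term G t"
| "commutator_term G (Twist t) = twist G (commutator_term G t)"

definition commutator_map ::
  "('k, 'r) ring_scheme \<Rightarrow> ('k, 'a) hom_module \<Rightarrow> ('a ext_term \<Rightarrow> 'k) set \<Rightarrow> 'a"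
  where "commutator_map K G X = the_elem (lin_ext K G (commutator_term G) ` X)"

end

theory Submission
  imports Defs
begin

text \<open>Both sides of the isomorphism are kernels of the bracket on one and the same quotient of
  \<open>G \<otimes> G\<close>.

  Up to a rearrangement of terms, the boundary of \<open>x \<otimes> y \<otimes> z\<close> in degree two is
  \<open>\<alpha> x \<otimes> [y, z] - ([x, y] \<otimes> \<alpha> z - [x, z] \<otimes> \<alpha> y)\<close>, the difference of the two sides of the second
  relation between wedges; the first and third relations between wedges follow from the second by exchanging
  \<open>y\<close> and \<open>z\<close>.  Hence \<open>(x, y) \<mapsto> x \<otimes> y\<close> modulo boundaries and \<open>(x, y) \<mapsto> x \<curlywedge> y\<close> are
  bilinear maps subject to the same identity, that of a \<open>leibniz_pairing\<close>.  It remains to see that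
  the exterior product has no further elements and no further relations.

  There are no further elements because \<open>[x \<curlywedge> y, x' \<curlywedge> y'] = [x, y] \<curlywedge> [x', y']\<close>
  makes every bracket of wedges a wedge (\<open>cls_term_is_wedge\<close>).  There are no further relations because
  every Leibniz pairing \<open>\<tau>\<close> extends to a map on terms that sends a bracket \<open>[s, t]\<close> to
  \<open>\<tau> (\<lambda> s) (\<lambda> t)\<close>, where \<open>\<lambda>\<close> is the commutator; this map respects all relations because of the
  identity of \<open>\<tau>\<close>, and so does \<open>\<lambda>\<close>, the case in which \<open>\<tau>\<close> is the bracket of \<open>G\<close>; together they
  vanish on the ideal that the relations generate (\<open>ext_map_ideal\<close>).  Applied to the pairing into the tensors modulo boundaries, this shows that
  a tensor whose wedge vanishes is a boundary (\<open>wedge_zero_iff_boundary\<close>).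

  Finally \<open>d\<^sub>2\<close> is minus the bracket under \<open>CL\<^sub>1 = G\<close> (\<open>D_2_mem_ker_iff\<close>), so the cycles modulo
  boundaries correspond to the kernel of \<open>\<lambda>\<close> on the exterior product.  Iterated quotients
  are avoided by mapping the formal combinations of pairs with vanishing commutator onto both sides
  and comparing the kernels (\<open>hom_vs_isomorphic_of_common_cover\<close>).\<close>

section \<open>Linear maps, submodules and quotients\<close>

locale linear_map = V: module K V + W: module K W
  for K :: "('k, 'r) ring_scheme" and V :: "('k, 'a, 'm) module_scheme"
    and W :: "('k, 'b, 'n) module_scheme" +
  fixes f :: "'a \<Rightarrow> 'b"
  assumes map_closed: "x \<in> carrier V \<Longrightarrow> f x \<in> carrier W"
    and map_add: "\<lbrakk>x \<in> carrier V; y \<in> carrier V\<rbrakk> \<Longrightarrow> f (x \<oplus>\<^bsub>V\<^esub> y) = f x \<oplus>\<^bsub>W\<^esub> f y"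
    and map_smult: "\<lbrakk>c \<in> carrier K; x \<in> carrier V\<rbrakk> \<Longrightarrow> f (c \<odot>\<^bsub>V\<^esub> x) = c \<odot>\<^bsub>W\<^esub> f x"
begin

lemma map_zero: "f \<zero>\<^bsub>V\<^esub> = \<zero>\<^bsub>W\<^esub>"
proof -
  have "f \<zero>\<^bsub>V\<^esub> \<oplus>\<^bsub>W\<^esub> f \<zero>\<^bsub>V\<^esub> = f \<zero>\<^bsub>V\<^esub>"
    using map_add[of "\<zero>\<^bsub>V\<^esub>" "\<zero>\<^bsub>V\<^esub>"] by simp
  then show ?thesis
    using map_closed[of "\<zero>\<^bsub>V\<^esub>"] W.M.add.r_cancel_one' by (metis V.M.zero_closed)
qed

lemma map_a_inv: "x \<in> carrier V \<Longrightarrow> f (\<ominus>\<^bsub>V\<^esub> x) = \<ominus>\<^bsub>W\<^esub> f x"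
  using map_add[of "\<ominus>\<^bsub>V\<^esub> x" x]
  by (simp add: V.M.l_neg map_zero map_closed W.M.minus_equality)

lemma map_minus: "\<lbrakk>x \<in> carrier V; y \<in> carrier V\<rbrakk> \<Longrightarrow> f (x \<ominus>\<^bsub>V\<^esub> y) = f x \<ominus>\<^bsub>W\<^esub> f y"
  by (simp add: a_minus_def map_add map_a_inv)

lemma preimage_submodule:
  assumes "submodule N K W"
  shows "submodule {x \<in> carrier V. f x \<in> N} K V"
  using W.submoduleE[OF assms] submodule.axioms(1)[OF assms, THEN subgroup.one_closed]
  by (intro V.submoduleI) (auto simp: map_zero map_a_inv map_add map_smult)

lemma image_submodule:
  assumes "submodule N K V"
  shows "submodule (f ` N) K W"
proof -
  have N: "N \<subseteq> carrier V" and zero: "\<zero>\<^bsub>V\<^esub> \<in> N"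
    using V.submoduleE[OF assms] submodule.axioms(1)[OF assms, THEN subgroup.one_closed] by auto
  show ?thesis
  proof (rule W.submoduleI)
    show "f ` N \<subseteq> carrier W" using N map_closed by auto
    show "\<zero>\<^bsub>W\<^esub> \<in> f ` N" using zero map_zero by (metis imageI)
    show "\<ominus>\<^bsub>W\<^esub> a \<in> f ` N" if "a \<in> f ` N" for a
      using that N V.submoduleE(3)[OF assms]
      by (force simp: map_a_inv[symmetric] subset_iff)
    show "a \<oplus>\<^bsub>W\<^esub> b \<in> f ` N" if "a \<in> f ` N" "b \<in> f ` N" for a b
      using that N V.submoduleE(5)[OF assms] by (force simp: map_add[symmetric] subset_iff)
    show "c \<odot>\<^bsub>W\<^esub> a \<in> f ` N" if "c \<in> carrier K" "a \<in> f ` N" for c a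
      using that N V.submoduleE(4)[OF assms] by (force simp: map_smult[symmetric] subset_iff)
  qed
qed

end

lemma linear_mapI:
  assumes "module K V" "module K W"
    and "\<And>x. x \<in> carrier V \<Longrightarrow> f x \<in> carrier W"
    and "\<And>x y. \<lbrakk>x \<in> carrier V; y \<in> carrier V\<rbrakk> \<Longrightarrow> f (x \<oplus>\<^bsub>V\<^esub> y) = f x \<oplus>\<^bsub>W\<^esub> f y"
    and "\<And>c x. \<lbrakk>c \<in> carrier K; x \<in> carrier V\<rbrakk> \<Longrightarrow> f (c \<odot>\<^bsub>V\<^esub> x) = c \<odot>\<^bsub>W\<^esub> f x"
  shows "linear_map K V W f"
  using assms by (intro linear_map.intro linear_map_axioms.intro)

lemma linear_map_uminus:
  assumes "linear_map K V W f"
  shows "linear_map K V W (\<lambda>x. \<ominus>\<^bsub>W\<^esub> f x)"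
proof -
  interpret f: linear_map K V W f by fact
  show ?thesis
    by unfold_locales
      (auto simp: f.map_closed f.map_add f.map_smult f.W.M.minus_add f.W.smult_r_minus)
qed

lemma linear_map_comp:
  assumes "linear_map K U V f" "linear_map K V W g"
  shows "linear_map K U W (\<lambda>x. g (f x))"
proof -
  interpret f: linear_map K U V f by fact
  interpret g: linear_map K V W g by fact
  show ?thesis
    by unfold_locales (auto simp: f.map_closed f.map_add f.map_smult g.map_closed g.map_add g.map_smult)
qed

lemma (in module) minus_eq_zero_iff:
  "\<lbrakk>x \<in> carrier M; y \<in> carrier M\<rbrakk> \<Longrightarrow> x \<ominus>\<^bsub>M\<^esub> y = \<zero>\<^bsub>M\<^esub> \<longleftrightarrow> x = y"
  unfolding a_minus_def using M.minus_equality[of x "\<ominus>\<^bsub>M\<^esub> y"] M.minus_minus[of y] M.r_neg[of y] by auto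

lemma (in module) a_inv_eq_zero_iff: "x \<in> carrier M \<Longrightarrow> \<ominus>\<^bsub>M\<^esub> x = \<zero>\<^bsub>M\<^esub> \<longleftrightarrow> x = \<zero>\<^bsub>M\<^esub>"
  using M.minus_equality[of "\<zero>\<^bsub>M\<^esub>" "\<zero>\<^bsub>M\<^esub>"] M.minus_minus[of x] by auto

lemma (in module) singleton_zero_submodule: "submodule {\<zero>\<^bsub>M\<^esub>} R M"
  by (rule submoduleI) auto

lemma (in module) Inter_submodule:
  assumes "S \<noteq> {}" "\<And>N. N \<in> S \<Longrightarrow> submodule N R M"
  shows "submodule (\<Inter>S) R M"
proof (rule submoduleI)
  show "\<Inter>S \<subseteq> carrier M" using assms submoduleE(1) by blast
  show "\<zero>\<^bsub>M\<^esub> \<in> \<Inter>S"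
    using assms(2)[THEN submodule.axioms(1), THEN subgroup.one_closed] by auto
qed (use assms(2) submoduleE(3-5) in \<open>simp_all\<close>)

text \<open>A linear map that sends the defining relations of a presentation into a submodule sends all their
  consequences there, so it descends to the presented space.\<close>

lemma (in linear_map) map_hull_subset:
  assumes "submodule N K W" "S \<subseteq> carrier V" "\<And>r. r \<in> S \<Longrightarrow> f r \<in> N"
    and "x \<in> (\<lambda>N. submodule N K V) hull S"
  shows "f x \<in> N"
  using hull_minimal[of S "{x \<in> carrier V. f x \<in> N}" "\<lambda>N. submodule N K V"]
    preimage_submodule[OF assms(1)] assms by auto

lemma (in module) submodule_hull: 
  assumes "S \<subseteq> carrier M"
  shows "submodule ((\<lambda>N. submodule N R M) hull S) R M"
  unfolding hull_def using assms carrier_is_submodule by (intro Inter_submodule) auto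

lemma (in hom_vector_space) twist_linear: "linear_map K V V (twist V)"
  by (intro linear_mapI V.module_axioms twist_closed twist_add twist_smult)

text \<open>Every axiom of a module is an identity or an existence statement that survives in an image.
  The zero of \<open>W\<close> is a field of the record, hence the separate hypothesis on \<open>f \<zero>\<close>.\<close>

lemma module_surjective_image:
  assumes "module K V" "f ` carrier V = carrier W" "f \<zero>\<^bsub>V\<^esub> = \<zero>\<^bsub>W\<^esub>"
    and add: "\<And>x y. \<lbrakk>x \<in> carrier V; y \<in> carrier V\<rbrakk> \<Longrightarrow> f (x \<oplus>\<^bsub>V\<^esub> y) = f x \<oplus>\<^bsub>W\<^esub> f y"
    and smult: "\<And>c x. \<lbrakk>c \<in> carrier K; x \<in> carrier V\<rbrakk> \<Longrightarrow> f (c \<odot>\<^bsub>V\<^esub> x) = c \<odot>\<^bsub>W\<^esub> f x"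
  shows "module K W"
proof -
  interpret V: module K V by fact
  have closed: "f x \<in> carrier W" if "x \<in> carrier V" for x using that assms(2) by auto
  have lift: "\<exists>x\<in>carrier V. w = f x" if "w \<in> carrier W" for w using that assms(2) by auto
  show ?thesis
  proof (rule moduleI)
    show "cring K" by (rule V.R.is_cring)
    show "abelian_group W"
    proof (rule abelian_groupI)
      fix x y z assume "x \<in> carrier W" "y \<in> carrier W" "z \<in> carrier W"
      then obtain a b c where abc: "a \<in> carrier V" "b \<in> carrier V" "c \<in> carrier V"
        "x = f a" "y = f b" "z = f c" using lift by metis
      show "x \<oplus>\<^bsub>W\<^esub> y \<in> carrier W" using abc by (simp add: closed add[symmetric])
      show "x \<oplus>\<^bsub>W\<^esub> y \<oplus>\<^bsub>W\<^esub> z = x \<oplus>\<^bsub>W\<^esub> (y \<oplus>\<^bsub>W\<^esub> z)"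
        using abc by (simp add: add[symmetric] V.M.a_assoc)
      show "x \<oplus>\<^bsub>W\<^esub> y = y \<oplus>\<^bsub>W\<^esub> x" using abc by (simp add: add[symmetric] V.M.a_comm)
      show "\<zero>\<^bsub>W\<^esub> \<oplus>\<^bsub>W\<^esub> x = x" using abc assms(3) by (metis add V.M.zero_closed V.M.l_zero)
      show "\<exists>y\<in>carrier W. y \<oplus>\<^bsub>W\<^esub> x = \<zero>\<^bsub>W\<^esub>"
        using abc assms(3) closed by (metis add V.M.a_inv_closed V.M.l_neg)
    next
      show "\<zero>\<^bsub>W\<^esub> \<in> carrier W" using closed assms(3) by (metis V.M.zero_closed)
    qed
  next
    fix a b x y assume "a \<in> carrier K" "b \<in> carrier K" "x \<in> carrier W" "y \<in> carrier W"
    then show "a \<odot>\<^bsub>W\<^esub> x \<in> carrier W"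
      and "(a \<oplus>\<^bsub>K\<^esub> b) \<odot>\<^bsub>W\<^esub> x = a \<odot>\<^bsub>W\<^esub> x \<oplus>\<^bsub>W\<^esub> b \<odot>\<^bsub>W\<^esub> x"
      and "a \<odot>\<^bsub>W\<^esub> (x \<oplus>\<^bsub>W\<^esub> y) = a \<odot>\<^bsub>W\<^esub> x \<oplus>\<^bsub>W\<^esub> a \<odot>\<^bsub>W\<^esub> y"
      and "(a \<otimes>\<^bsub>K\<^esub> b) \<odot>\<^bsub>W\<^esub> x = a \<odot>\<^bsub>W\<^esub> (b \<odot>\<^bsub>W\<^esub> x)"
      by (auto dest!: lift simp: closed add[symmetric] smult[symmetric]
          V.smult_l_distr V.smult_r_distr V.smult_assoc1)
  next
    show "\<one>\<^bsub>K\<^esub> \<odot>\<^bsub>W\<^esub> x = x" if "x \<in> carrier W" for x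
      using lift[OF that] by (auto simp: smult[symmetric])
  qed
qed

lemma hom_vector_space_surjective_image:
  assumes "hom_vector_space K V" "f \<in> hom_vs_hom K V W"
    and "f ` carrier V = carrier W" "f \<zero>\<^bsub>V\<^esub> = \<zero>\<^bsub>W\<^esub>"
  shows "hom_vector_space K W"
proof -
  interpret V: hom_vector_space K V by fact
  have hom: "\<And>x y. \<lbrakk>x \<in> carrier V; y \<in> carrier V\<rbrakk> \<Longrightarrow> f (x \<oplus>\<^bsub>V\<^esub> y) = f x \<oplus>\<^bsub>W\<^esub> f y"
    "\<And>c x. \<lbrakk>c \<in> carrier K; x \<in> carrier V\<rbrakk> \<Longrightarrow> f (c \<odot>\<^bsub>V\<^esub> x) = c \<odot>\<^bsub>W\<^esub> f x"
    "\<And>x. x \<in> carrier V \<Longrightarrow> f (twist V x) = twist W (f x)"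
    using assms(2) by (auto simp: hom_vs_hom_def)
  have lift: "\<exists>x\<in>carrier V. w = f x" if "w \<in> carrier W" for w using that assms(3) by auto
  have closed: "f x \<in> carrier W" if "x \<in> carrier V" for x using that assms(3) by auto
  show ?thesis
  proof (rule hom_vector_space.intro)
    show "field K" by (rule V.K.field_axioms)
    show "module K W" using V.V.module_axioms assms(3,4) hom(1,2) by (rule module_surjective_image)
    show "hom_vector_space_axioms K W"
      by standard (auto dest!: lift simp: hom[symmetric] closed
          V.twist_closed V.twist_add V.twist_smult)
  qed
qed

text \<open>Two quotients of one space by the same subspace are isomorphic.  The axioms of a
  Hom-vector space carry over from \<open>Z\<close> to \<open>V\<close> and \<open>W\<close> along the covers.\<close>

lemma hom_vs_isomorphic_of_common_cover:
  assumes "hom_vector_space K Z" "f \<in> hom_vs_hom K Z V" "g \<in> hom_vs_hom K Z W"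
    and "f ` carrier Z = carrier V" "g ` carrier Z = carrier W"
    and "f \<zero>\<^bsub>Z\<^esub> = \<zero>\<^bsub>V\<^esub>" "g \<zero>\<^bsub>Z\<^esub> = \<zero>\<^bsub>W\<^esub>"
    and ker: "\<And>z. z \<in> carrier Z \<Longrightarrow> f z = \<zero>\<^bsub>V\<^esub> \<longleftrightarrow> g z = \<zero>\<^bsub>W\<^esub>"
  shows "hom_vs_isomorphic K V W"
proof -
  interpret Z: hom_vector_space K Z by fact
  interpret V: hom_vector_space K V
    by (rule hom_vector_space_surjective_image[OF assms(1,2,4,6)])
  interpret W: hom_vector_space K W
    by (rule hom_vector_space_surjective_image[OF assms(1,3,5,7)])
  interpret f: linear_map K Z V f using assms(2) by unfold_locales (auto simp: hom_vs_hom_def)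
  interpret g: linear_map K Z W g using assms(3) by unfold_locales (auto simp: hom_vs_hom_def)
  have same_fibres: "f x = f y \<longleftrightarrow> g x = g y" if "x \<in> carrier Z" "y \<in> carrier Z" for x y
    using ker[of "x \<ominus>\<^bsub>Z\<^esub> y"] that
    by (simp add: f.map_minus g.map_minus f.map_closed g.map_closed V.V.minus_eq_zero_iff W.V.minus_eq_zero_iff)
  define h where "h v = g (SOME z. z \<in> carrier Z \<and> f z = v)" for v
  have h: "h (f z) = g z" if "z \<in> carrier Z" for z
    unfolding h_def using someI[of "\<lambda>z'. z' \<in> carrier Z \<and> f z' = f z" z] that
    by (metis same_fibres)
  have lift: "\<exists>z\<in>carrier Z. v = f z" if "v \<in> carrier V" for v using that assms(4) by auto
  have twists: "f (twist Z z) = twist V (f z)" "g (twist Z z) = twist W (g z)"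
    if "z \<in> carrier Z" for z using that assms(2,3) by (auto simp: hom_vs_hom_def)
  have "h \<in> hom_vs_hom K V W"
    unfolding hom_vs_hom_def
    by (auto dest!: lift simp: h g.map_closed f.map_add[symmetric] f.map_smult[symmetric]
        twists[symmetric] Z.twist_closed)
      (auto simp: g.map_add g.map_smult twists)
  moreover have "bij_betw h (carrier V) (carrier W)"
    unfolding bij_betw_def
  proof
    show "inj_on h (carrier V)" by (rule inj_onI) (auto dest!: lift simp: h same_fibres)
    show "h ` carrier V = carrier W"
      unfolding assms(4,5)[symmetric] image_image by (intro image_cong refl h)
  qed
  ultimately show ?thesis
    unfolding hom_vs_isomorphic_def using V.hom_vector_space_axioms W.hom_vector_space_axioms by blast
qed

lemma (in module) coset_eq_iff:
  assumes "submodule N R M" "x \<in> carrier M" "y \<in> carrier M"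
  shows "N +>\<^bsub>M\<^esub> x = N +>\<^bsub>M\<^esub> y \<longleftrightarrow> x \<ominus>\<^bsub>M\<^esub> y \<in> N"
proof -
  have N: "subgroup N (add_monoid M)" "N \<subseteq> carrier M"
    using submodule.axioms(1)[OF assms(1)] submoduleE(1)[OF assms(1)] by auto
  show ?thesis
  proof
    assume "N +>\<^bsub>M\<^esub> x = N +>\<^bsub>M\<^esub> y"
    then have "N +>\<^bsub>M\<^esub> (x \<ominus>\<^bsub>M\<^esub> y) = N"
      unfolding a_minus_def using assms(2,3) N(2) by (rule M.a_coset_add_inv2)
    then show "x \<ominus>\<^bsub>M\<^esub> y \<in> N" using M.a_coset_join1[OF _ _ N(1)] assms(2,3) by simp
  next
    assume "x \<ominus>\<^bsub>M\<^esub> y \<in> N"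
    then have "N +>\<^bsub>M\<^esub> (x \<ominus>\<^bsub>M\<^esub> y) = N" using M.a_coset_join2[OF _ N(1)] assms(2,3) by simp
    then show "N +>\<^bsub>M\<^esub> x = N +>\<^bsub>M\<^esub> y"
      unfolding a_minus_def using assms(2,3) N(2) by (rule M.a_coset_add_inv1)
  qed
qed

lemma (in module) mem_coset_iff:
  assumes "submodule N R M" "x \<in> carrier M"
  shows "y \<in> N +>\<^bsub>M\<^esub> x \<longleftrightarrow> y \<in> carrier M \<and> N +>\<^bsub>M\<^esub> y = N +>\<^bsub>M\<^esub> x"
proof -
  have N: "subgroup N (add_monoid M)" "N \<subseteq> carrier M"
    using submodule.axioms(1)[OF assms(1)] submoduleE(1)[OF assms(1)] by auto
  show ?thesis
  proof
    assume "y \<in> N +>\<^bsub>M\<^esub> x"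
    then show "y \<in> carrier M \<and> N +>\<^bsub>M\<^esub> y = N +>\<^bsub>M\<^esub> x"
      using M.a_repr_independence[OF _ assms(2) N(1)] M.a_r_coset_subset_G[OF N(2) assms(2)] by auto
  next
    assume "y \<in> carrier M \<and> N +>\<^bsub>M\<^esub> y = N +>\<^bsub>M\<^esub> x"
    then show "y \<in> N +>\<^bsub>M\<^esub> x" using M.add.rcos_self[OF _ N(1), of y] by (simp add: a_r_coset_def)
  qed
qed

text \<open>The union that defines \<open>quot_map\<close> is taken over equal cosets: the images of two elements of
  one coset of \<open>M\<close> differ by an element of \<open>f ` M\<close>.\<close>

lemma (in linear_map) quot_map_coset:
  assumes "submodule M K V" "submodule N K W" "f ` M \<subseteq> N" "x \<in> carrier V"
  shows "quot_map W N f (M +>\<^bsub>V\<^esub> x) = N +>\<^bsub>W\<^esub> f x"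
proof -
  have "N +>\<^bsub>W\<^esub> f y = N +>\<^bsub>W\<^esub> f x" if "y \<in> M +>\<^bsub>V\<^esub> x" for y
  proof -
    have y: "y \<in> carrier V" "y \<ominus>\<^bsub>V\<^esub> x \<in> M"
      using that assms V.mem_coset_iff V.coset_eq_iff by auto
    then show ?thesis using assms(3,4) W.coset_eq_iff[OF assms(2)] by (auto simp: map_closed map_minus[symmetric])
  qed
  moreover have "x \<in> M +>\<^bsub>V\<^esub> x" using V.mem_coset_iff assms by blast
  ultimately show ?thesis unfolding quot_map_def by blast
qed

locale hom_quotient = hom_vector_space K V
  for K :: "('k, 'r) ring_scheme" and V :: "('k, 'a) hom_module" +
  fixes N :: "'a set"
  assumes submod: "submodule N K V" and twist_stable: "twist V ` N \<subseteq> N"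
begin

abbreviation cls where "cls x \<equiv> N +>\<^bsub>V\<^esub> x"
abbreviation quot where "quot \<equiv> quot_hom_module V N"

lemma carrier_quot: "carrier quot = cls ` carrier V"
  by (auto simp: quot_hom_module_def A_RCOSETS_def')

lemma cls_zero: "cls \<zero>\<^bsub>V\<^esub> = \<zero>\<^bsub>quot\<^esub>"
  using V.submoduleE(1)[OF submod] by (simp add: quot_hom_module_def)

lemma cls_add: "\<lbrakk>x \<in> carrier V; y \<in> carrier V\<rbrakk> \<Longrightarrow> cls (x \<oplus>\<^bsub>V\<^esub> y) = cls x \<oplus>\<^bsub>quot\<^esub> cls y"
proof -
  assume xy: "x \<in> carrier V" "y \<in> carrier V"
  have "normal N (add_monoid V)"
    using V.M.a_comm_group submodule.axioms(1)[OF submod] by (rule comm_group.normal_iff_subgroup[THEN iffD2])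
  from normal.rcos_sum[OF this] xy show ?thesis
    by (simp add: quot_hom_module_def set_add_def a_r_coset_def)
qed

lemma cls_smult: "\<lbrakk>c \<in> carrier K; x \<in> carrier V\<rbrakk> \<Longrightarrow> cls (c \<odot>\<^bsub>V\<^esub> x) = c \<odot>\<^bsub>quot\<^esub> cls x"
proof -
  assume c: "c \<in> carrier K" and x: "x \<in> carrier V"
  interpret s: linear_map K V V "\<lambda>x. c \<odot>\<^bsub>V\<^esub> x"
    by (rule linear_mapI)
      (use c in \<open>auto intro: V.module_axioms V.smult_r_distr simp: V.smult_assoc1[symmetric] K.m_comm\<close>)
  show ?thesis
    using s.quot_map_coset[OF submod submod _ x] V.submoduleE(4)[OF submod c]
    by (auto simp: quot_hom_module_def)
qed

lemma cls_twist: "x \<in> carrier V \<Longrightarrow> cls (twist V x) = twist quot (cls x)"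
  using linear_map.quot_map_coset[OF twist_linear submod submod twist_stable]
  by (simp add: quot_hom_module_def)

lemma cls_hom: "cls \<in> hom_vs_hom K V quot"
  by (auto simp: hom_vs_hom_def carrier_quot cls_add cls_smult cls_twist)

lemma quot_hom_vector_space: "hom_vector_space K quot"
  using hom_vector_space_axioms cls_hom carrier_quot[symmetric] cls_zero
  by (rule hom_vector_space_surjective_image)

sublocale quot: hom_vector_space K quot by (rule quot_hom_vector_space)

sublocale cls: linear_map K V quot cls
  by (intro linear_mapI V.module_axioms quot.V.module_axioms cls_add cls_smult)
    (simp_all add: carrier_quot)

lemma cls_eq_zero_iff: "x \<in> carrier V \<Longrightarrow> cls x = \<zero>\<^bsub>quot\<^esub> \<longleftrightarrow> x \<in> N"
  using V.coset_eq_iff[OF submod, of x "\<zero>\<^bsub>V\<^esub>"] V.M.minus_equality[of "\<zero>\<^bsub>V\<^esub>" "\<zero>\<^bsub>V\<^esub>"]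
  by (simp add: cls_zero a_minus_def)

end

section \<open>Free vector spaces\<close>

text \<open>The formal combinations of lists and those of terms are free vector spaces that carry further
  operations; only the fields of a vector space are prescribed here, so that both are instances.\<close>

locale free_space = K: field K for K :: "('k, 'r) ring_scheme" +
  fixes B :: "'b set" and F :: "('k, 'b \<Rightarrow> 'k, 'm) module_scheme"
  assumes carrier_F: "carrier F = carrier (free_vs K B)"
    and zero_F: "zero F = zero (free_vs K B)"
    and add_F: "add F = add (free_vs K B)"
    and smult_F: "smult F = smult (free_vs K B)"
begin

lemma mem_iff: "f \<in> carrier F \<longleftrightarrow> (\<forall>b\<in>B. f b \<in> carrier K) \<and> (\<forall>b. b \<notin> B \<longrightarrow> f b = \<zero>\<^bsub>K\<^esub>)
    \<and> finite {b. f b \<noteq> \<zero>\<^bsub>K\<^esub>}"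
  by (simp add: carrier_F free_vs_def)

lemma coeff_closed: "f \<in> carrier F \<Longrightarrow> f b \<in> carrier K"
  unfolding mem_iff by (cases "b \<in> B") auto

lemma supp_subset: "f \<in> carrier F \<Longrightarrow> {b. f b \<noteq> \<zero>\<^bsub>K\<^esub>} \<subseteq> B"
  unfolding mem_iff by auto

lemma supp_finite: "f \<in> carrier F \<Longrightarrow> finite {b. f b \<noteq> \<zero>\<^bsub>K\<^esub>}"
  unfolding mem_iff by auto

lemma zero_eq: "\<zero>\<^bsub>F\<^esub> = (\<lambda>_. \<zero>\<^bsub>K\<^esub>)" and add_eq: "f \<oplus>\<^bsub>F\<^esub> g = (\<lambda>b. f b \<oplus>\<^bsub>K\<^esub> g b)"
  and smult_eq: "c \<odot>\<^bsub>F\<^esub> f = (\<lambda>b. c \<otimes>\<^bsub>K\<^esub> f b)"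
  by (simp_all add: zero_F add_F smult_F free_vs_def)

text \<open>A linear extension sees only the vector space structure of its target.\<close>

lemma lin_ext_free_vs: "lin_ext K (free_vs K B) h = lin_ext K F h"
proof (rule ext)
  show "lin_ext K (free_vs K B) h f = lin_ext K F h f" for f
    by (simp only: lin_ext_def finsum_def finprod_def partial_object.simps monoid.simps
        carrier_F zero_F add_F smult_F)
qed

lemma add_mem: "f \<in> carrier F \<Longrightarrow> g \<in> carrier F \<Longrightarrow> f \<oplus>\<^bsub>F\<^esub> g \<in> carrier F"
  unfolding mem_iff add_eq
  by (auto intro!: finite_subset[of "{b. f b \<oplus>\<^bsub>K\<^esub> g b \<noteq> \<zero>\<^bsub>K\<^esub>}" "{b. f b \<noteq> \<zero>\<^bsub>K\<^esub>} \<union> {b. g b \<noteq> \<zero>\<^bsub>K\<^esub>}"])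

lemma smult_mem: "c \<in> carrier K \<Longrightarrow> f \<in> carrier F \<Longrightarrow> c \<odot>\<^bsub>F\<^esub> f \<in> carrier F"
  unfolding mem_iff smult_eq
  by (auto intro!: finite_subset[of "{b. c \<otimes>\<^bsub>K\<^esub> f b \<noteq> \<zero>\<^bsub>K\<^esub>}" "{b. f b \<noteq> \<zero>\<^bsub>K\<^esub>}"])

lemma zero_mem: "\<zero>\<^bsub>F\<^esub> \<in> carrier F"
  unfolding mem_iff zero_eq by auto

sublocale module K F
proof (rule moduleI)
  show "cring K" by (rule K.is_cring)
  show "abelian_group F"
  proof (rule abelian_groupI)
    fix x assume x: "x \<in> carrier F"
    have "(\<ominus>\<^bsub>K\<^esub> \<one>\<^bsub>K\<^esub>) \<odot>\<^bsub>F\<^esub> x \<oplus>\<^bsub>F\<^esub> x = \<zero>\<^bsub>F\<^esub>"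
      unfolding zero_eq add_eq smult_eq
      by (rule ext) (simp add: K.l_minus K.l_neg coeff_closed[OF x])
    then show "\<exists>y\<in>carrier F. y \<oplus>\<^bsub>F\<^esub> x = \<zero>\<^bsub>F\<^esub>" using smult_mem x by blast
  qed (auto simp: add_mem zero_mem, auto simp: zero_eq add_eq coeff_closed K.a_ac)
qed (auto simp: smult_mem, auto simp: add_eq smult_eq coeff_closed K.l_distr K.r_distr K.m_assoc)

lemma basis_vec_closed: "b \<in> B \<Longrightarrow> basis_vec K b \<in> carrier F"
  unfolding mem_iff basis_vec_def by auto

lemma lin_ext_eq_finsum:
  assumes "module K W" "h \<in> B \<rightarrow> carrier W" "f \<in> carrier F"
    and "finite S" "{b. f b \<noteq> \<zero>\<^bsub>K\<^esub>} \<subseteq> S" "S \<subseteq> B"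
  shows "lin_ext K W h f = (\<Oplus>\<^bsub>W\<^esub> b\<in>S. f b \<odot>\<^bsub>W\<^esub> h b)"
proof -
  interpret W: module K W by fact
  show ?thesis unfolding lin_ext_def
    by (rule W.M.add.finprod_mono_neutral_cong_left)
      (use assms in \<open>auto simp: coeff_closed[OF assms(3)] Pi_iff subset_iff intro!: W.smult_l_null\<close>)
qed

lemma lin_ext_linear:
  assumes "module K W" "h \<in> B \<rightarrow> carrier W"
  shows "linear_map K F W (lin_ext K W h)"
proof -
  interpret W: module K W by fact
  have hc: "h b \<in> carrier W" if "b \<in> B" for b using that assms(2) by auto
  show ?thesis
  proof (rule linear_mapI)
    show "module K F" by (rule module_axioms)
    show "module K W" by fact
    show "lin_ext K W h x \<in> carrier W" if "x \<in> carrier F" for x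
      unfolding lin_ext_def using that supp_subset[OF that] hc
      by (intro W.M.add.finprod_closed) (auto simp: coeff_closed)
    show "lin_ext K W h (x \<oplus>\<^bsub>F\<^esub> y) = lin_ext K W h x \<oplus>\<^bsub>W\<^esub> lin_ext K W h y"
      if xy: "x \<in> carrier F" "y \<in> carrier F" for x y
    proof -
      define S where "S = {b. x b \<noteq> \<zero>\<^bsub>K\<^esub>} \<union> {b. y b \<noteq> \<zero>\<^bsub>K\<^esub>}"
      have S: "finite S" "S \<subseteq> B"
        using xy supp_finite supp_subset unfolding S_def by auto
      have supp: "{b. x b \<noteq> \<zero>\<^bsub>K\<^esub>} \<subseteq> S" "{b. y b \<noteq> \<zero>\<^bsub>K\<^esub>} \<subseteq> S" "{b. (x \<oplus>\<^bsub>F\<^esub> y) b \<noteq> \<zero>\<^bsub>K\<^esub>} \<subseteq> S"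
        by (auto simp: S_def add_eq)
      have "lin_ext K W h (x \<oplus>\<^bsub>F\<^esub> y) = (\<Oplus>\<^bsub>W\<^esub> b\<in>S. (x \<oplus>\<^bsub>F\<^esub> y) b \<odot>\<^bsub>W\<^esub> h b)"
        using assms add_mem[OF xy] S supp by (intro lin_ext_eq_finsum)
      also have "\<dots> = (\<Oplus>\<^bsub>W\<^esub> b\<in>S. x b \<odot>\<^bsub>W\<^esub> h b \<oplus>\<^bsub>W\<^esub> y b \<odot>\<^bsub>W\<^esub> h b)"
        using S xy by (intro W.M.add.finprod_cong')
          (auto simp: add_eq coeff_closed hc subset_iff W.smult_l_distr)
      also have "\<dots> = (\<Oplus>\<^bsub>W\<^esub> b\<in>S. x b \<odot>\<^bsub>W\<^esub> h b) \<oplus>\<^bsub>W\<^esub> (\<Oplus>\<^bsub>W\<^esub> b\<in>S. y b \<odot>\<^bsub>W\<^esub> h b)"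
        using S xy by (intro W.M.finsum_addf) (auto simp: coeff_closed hc subset_iff)
      also have "\<dots> = lin_ext K W h x \<oplus>\<^bsub>W\<^esub> lin_ext K W h y"
        using assms xy S supp by (simp add: lin_ext_eq_finsum)
      finally show ?thesis .
    qed
    show "lin_ext K W h (c \<odot>\<^bsub>F\<^esub> x) = c \<odot>\<^bsub>W\<^esub> lin_ext K W h x"
      if c: "c \<in> carrier K" and x: "x \<in> carrier F" for c x
    proof -
      let ?S = "{b. x b \<noteq> \<zero>\<^bsub>K\<^esub>}"
      have S: "finite ?S" "?S \<subseteq> B" using x supp_finite supp_subset by auto
      have "lin_ext K W h (c \<odot>\<^bsub>F\<^esub> x) = (\<Oplus>\<^bsub>W\<^esub> b\<in>?S. (c \<odot>\<^bsub>F\<^esub> x) b \<odot>\<^bsub>W\<^esub> h b)"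
        using assms smult_mem[OF c x] S c by (intro lin_ext_eq_finsum) (auto simp: smult_eq)
      also have "\<dots> = (\<Oplus>\<^bsub>W\<^esub> b\<in>?S. c \<odot>\<^bsub>W\<^esub> (x b \<odot>\<^bsub>W\<^esub> h b))"
        using S x c by (intro W.M.add.finprod_cong')
          (auto simp: smult_eq coeff_closed hc subset_iff W.smult_assoc1)
      also have "\<dots> = c \<odot>\<^bsub>W\<^esub> lin_ext K W h x"
        unfolding lin_ext_def using S x c
        by (intro W.finsum_smult_ldistr[symmetric]) (auto simp: coeff_closed hc subset_iff)
      finally show ?thesis .
    qed
  qed
qed

lemma lin_ext_basis:
  assumes "module K W" "h \<in> B \<rightarrow> carrier W" "b \<in> B"
  shows "lin_ext K W h (basis_vec K b) = h b"
proof -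
  interpret W: module K W by fact
  have "lin_ext K W h (basis_vec K b) = (\<Oplus>\<^bsub>W\<^esub> b'\<in>{b}. basis_vec K b b' \<odot>\<^bsub>W\<^esub> h b')"
    using assms basis_vec_closed by (intro lin_ext_eq_finsum) (auto simp: basis_vec_def split: if_splits)
  also have "\<dots> = basis_vec K b b \<odot>\<^bsub>W\<^esub> h b"
  proof -
    define g where "g b' = basis_vec K b b' \<odot>\<^bsub>W\<^esub> h b'" for b'
    have "g b \<in> carrier W" using assms(2,3) by (auto simp: g_def basis_vec_def)
    then have "(\<Oplus>\<^bsub>W\<^esub> b'\<in>{b}. g b') = g b" using W.M.finsum_insert[of "{}" b g] by simp
    then show ?thesis by (simp add: g_def)
  qed
  also have "\<dots> = h b" using funcset_mem[OF assms(2,3)] by (simp add: basis_vec_def)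
  finally show ?thesis .
qed

text \<open>Induction on the support, removing one coefficient at a time.\<close>

lemma basis_span:
  assumes "submodule N K F" "\<And>b. b \<in> B \<Longrightarrow> basis_vec K b \<in> N"
  shows "carrier F \<subseteq> N"
proof
  fix f assume f: "f \<in> carrier F"
  have "f \<in> N" if "finite S" "f \<in> carrier F" "{b. f b \<noteq> \<zero>\<^bsub>K\<^esub>} = S" for S f
    using that
  proof (induction S arbitrary: f)
    case empty
    then have "f = \<zero>\<^bsub>F\<^esub>" by (auto simp: zero_eq)
    then show ?case using submodule.axioms(1)[OF assms(1), THEN subgroup.one_closed] by simp
  next
    case (insert b S)
    define g where "g = f(b := \<zero>\<^bsub>K\<^esub>)"
    have b: "b \<in> B" using insert.prems supp_subset by blast
    have supp_g: "{x. g x \<noteq> \<zero>\<^bsub>K\<^esub>} = S" using insert.prems insert.hyps by (auto simp: g_def)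
    have g: "g \<in> carrier F" unfolding mem_iff supp_g using insert.prems insert.hyps
      by (auto simp: g_def mem_iff)
    have "g \<in> N" using insert.IH[OF g supp_g] .
    moreover have "f = g \<oplus>\<^bsub>F\<^esub> f b \<odot>\<^bsub>F\<^esub> basis_vec K b"
      by (rule ext) (auto simp: add_eq smult_eq g_def basis_vec_def coeff_closed[OF insert.prems(1)])
    ultimately show ?case
      using submoduleE(4,5)[OF assms(1)] assms(2)[OF b] coeff_closed[OF insert.prems(1), of b] by metis
  qed
  then show "f \<in> N" using f supp_finite by blast
qed

lemma linear_eqI:
  assumes "linear_map K F W f" "linear_map K F W g"
    and "\<And>b. b \<in> B \<Longrightarrow> f (basis_vec K b) = g (basis_vec K b)" "x \<in> carrier F"
  shows "f x = g x"
proof -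
  interpret f: linear_map K F W f by fact
  interpret g: linear_map K F W g by fact
  have "submodule {x \<in> carrier F. f x = g x} K F"
    by (rule submoduleI) (auto simp: f.map_zero g.map_zero f.map_a_inv g.map_a_inv
        f.map_add g.map_add f.map_smult g.map_smult)
  from basis_span[OF this] assms(3,4) basis_vec_closed show ?thesis by blast
qed

text \<open>\<open>lin_ext\<close> is bilinear in the map and the vector; this gives the bracket of the free algebra
  its linearity in the second argument.\<close>

lemma lin_ext_linear_in_map:
  assumes "module K U" "module K W" "f \<in> carrier F"
    and "\<And>b. b \<in> B \<Longrightarrow> linear_map K U W (\<lambda>u. h u b)"
  shows "linear_map K U W (\<lambda>u. lin_ext K W (h u) f)"
proof -
  interpret U: module K U by fact
  interpret W: module K W by fact
  let ?S = "{b. f b \<noteq> \<zero>\<^bsub>K\<^esub>}"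
  have S: "finite ?S" "?S \<subseteq> B" using assms(3) supp_finite supp_subset by auto
  have hc: "h u b \<in> carrier W" if "u \<in> carrier U" "b \<in> B" for u b
    using that assms(4) linear_map.map_closed by metis
  have c: "f b \<in> carrier K" for b using coeff_closed assms(3) by auto
  show ?thesis
  proof (rule linear_mapI)
    fix x y assume xy: "x \<in> carrier U" "y \<in> carrier U"
    have "lin_ext K W (h (x \<oplus>\<^bsub>U\<^esub> y)) f = (\<Oplus>\<^bsub>W\<^esub> b\<in>?S. f b \<odot>\<^bsub>W\<^esub> h x b \<oplus>\<^bsub>W\<^esub> f b \<odot>\<^bsub>W\<^esub> h y b)"
      unfolding lin_ext_def using S xy
      by (intro W.M.add.finprod_cong')
        (auto simp: c hc subset_iff linear_map.map_add[OF assms(4)] W.smult_r_distr)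
    also have "\<dots> = lin_ext K W (h x) f \<oplus>\<^bsub>W\<^esub> lin_ext K W (h y) f"
      unfolding lin_ext_def using S xy by (intro W.M.finsum_addf) (auto simp: c hc subset_iff)
    finally show "lin_ext K W (h (x \<oplus>\<^bsub>U\<^esub> y)) f = lin_ext K W (h x) f \<oplus>\<^bsub>W\<^esub> lin_ext K W (h y) f" .
  next
    fix a x assume a: "a \<in> carrier K" and x: "x \<in> carrier U"
    have "lin_ext K W (h (a \<odot>\<^bsub>U\<^esub> x)) f = (\<Oplus>\<^bsub>W\<^esub> b\<in>?S. a \<odot>\<^bsub>W\<^esub> (f b \<odot>\<^bsub>W\<^esub> h x b))"
      unfolding lin_ext_def using S x a
      by (intro W.M.add.finprod_cong')
        (auto simp: c hc subset_iff linear_map.map_smult[OF assms(4)] W.smult_assoc1[symmetric] K.m_comm)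
    also have "\<dots> = a \<odot>\<^bsub>W\<^esub> lin_ext K W (h x) f"
      unfolding lin_ext_def using S x a
      by (intro W.finsum_smult_ldistr[symmetric]) (auto simp: c hc subset_iff)
    finally show "lin_ext K W (h (a \<odot>\<^bsub>U\<^esub> x)) f = a \<odot>\<^bsub>W\<^esub> lin_ext K W (h x) f" .
  next
    show "lin_ext K W (h x) f \<in> carrier W" if "x \<in> carrier U" for x
      unfolding lin_ext_def using that S hc
      by (intro W.M.add.finprod_closed) (auto simp: c)
  qed fact+
qed

end

section \<open>Leibniz pairings\<close>

locale leibniz = hom_leibniz_algebra K G
  for K :: "('k, 'r) ring_scheme" and G :: "('k, 'a) hom_module"

text \<open>A Leibniz pairing is a bilinear map that satisfies, against the bracket of \<open>G\<close>, the Hom-Leibniz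
  identity.  The other two identities between wedges follow from this one, and the boundary of
  \<open>x \<otimes> y \<otimes> z\<close> is this identity with all terms on one side; so both the exterior product and the
  cokernel of the boundary into degree two carry universal pairings of this kind.\<close>

locale leibniz_pairing = leibniz K G + W: hom_vector_space K W
  for K :: "('k, 'r) ring_scheme" and G :: "('k, 'a) hom_module"
    and W :: "('k, 'b) hom_module" +
  fixes \<tau> :: "'a \<Rightarrow> 'a \<Rightarrow> 'b"
  assumes linear_left: "y \<in> carrier G \<Longrightarrow> linear_map K G W (\<lambda>x. \<tau> x y)"
    and linear_right: "x \<in> carrier G \<Longrightarrow> linear_map K G W (\<lambda>y. \<tau> x y)"
    and pair_leibniz: "\<lbrakk>x \<in> carrier G; y \<in> carrier G; z \<in> carrier G\<rbrakk>
      \<Longrightarrow> \<tau> (twist G x) (y \<otimes>\<^bsub>G\<^esub> z)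
          = \<tau> (x \<otimes>\<^bsub>G\<^esub> y) (twist G z) \<ominus>\<^bsub>W\<^esub> \<tau> (x \<otimes>\<^bsub>G\<^esub> z) (twist G y)"
    and pair_twist: "\<lbrakk>x \<in> carrier G; y \<in> carrier G\<rbrakk>
      \<Longrightarrow> twist W (\<tau> x y) = \<tau> (twist G x) (twist G y)"
begin

lemma pair_closed: "\<lbrakk>x \<in> carrier G; y \<in> carrier G\<rbrakk> \<Longrightarrow> \<tau> x y \<in> carrier W"
  using linear_map.map_closed[OF linear_left] .

lemmas pair_add_left = linear_map.map_add[OF linear_left]
lemmas pair_add_right = linear_map.map_add[OF linear_right]
lemmas pair_smult_left = linear_map.map_smult[OF linear_left]
lemmas pair_smult_right = linear_map.map_smult[OF linear_right]
lemmas pair_zero_left = linear_map.map_zero[OF linear_left]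
lemmas pair_zero_right = linear_map.map_zero[OF linear_right]

text \<open>The right-hand side of the Hom-Leibniz identity changes sign when \<open>y\<close> and \<open>z\<close> are exchanged.\<close>

lemma pair_alternating:
  assumes "x \<in> carrier G" "y \<in> carrier G" "z \<in> carrier G"
  shows "\<tau> (twist G x) (y \<otimes>\<^bsub>G\<^esub> z) = \<ominus>\<^bsub>W\<^esub> \<tau> (twist G x) (z \<otimes>\<^bsub>G\<^esub> y)"
  using assms by (simp add: pair_leibniz pair_closed bracket_closed twist_closed a_minus_def
      W.V.M.minus_add W.V.M.a_comm)

text \<open>The Leibniz identity with \<open>y\<close> and \<open>z\<close> exchanged, solved for its last term.\<close>

lemma pair_bracket_left:
  assumes "x \<in> carrier G" "y \<in> carrier G" "z \<in> carrier G"
  shows "\<tau> (x \<otimes>\<^bsub>G\<^esub> y) (twist G z) = \<tau> (x \<otimes>\<^bsub>G\<^esub> z) (twist G y) \<ominus>\<^bsub>W\<^esub> \<tau> (twist G x) (z \<otimes>\<^bsub>G\<^esub> y)"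
  using assms by (simp add: pair_leibniz pair_closed bracket_closed twist_closed a_minus_def
      W.V.M.minus_add W.V.M.r_neg1 W.V.M.r_neg2 W.V.M.a_assoc[symmetric] W.V.M.r_neg)

end

lemma (in leibniz) bracket_pairing: "leibniz_pairing K G G (mult G)"
proof (intro leibniz_pairing.intro leibniz_pairing_axioms.intro leibniz_axioms hom_vector_space_axioms)
  show "linear_map K G G (\<lambda>x. x \<otimes>\<^bsub>G\<^esub> y)" if "y \<in> carrier G" for y
    by (rule linear_mapI)
      (use that in \<open>auto intro: V.module_axioms simp: bracket_closed bracket_add_left bracket_smult_left\<close>)
  show "linear_map K G G (\<lambda>y. x \<otimes>\<^bsub>G\<^esub> y)" if "x \<in> carrier G" for x
    by (rule linear_mapI)
      (use that in \<open>auto intro: V.module_axioms simp: bracket_closed bracket_add_right bracket_smult_right\<close>)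
qed (simp_all add: hom_leibniz twist_bracket)

section \<open>Tensor powers and the boundary in low degrees\<close>

context leibniz
begin

abbreviation "T n \<equiv> free_tensor K G n"
abbreviation "N n \<equiv> tensor_ker K G n"
abbreviation pure :: "nat \<Rightarrow> 'a list \<Rightarrow> ('a list \<Rightarrow> 'k) set"
  where "pure n xs \<equiv> N n +>\<^bsub>T n\<^esub> basis_vec K xs"

lemma free_space_tensor: "free_space K (tensor_gens G n) (T n)"
  by (intro free_space.intro free_space_axioms.intro K.field_axioms)
    (simp_all add: free_tensor_def module.defs free_vs_def)

sublocale F: free_space K "tensor_gens G n" "T n" for n
  by (rule free_space_tensor)

lemma map_twist_gens: "xs \<in> tensor_gens G n \<Longrightarrow> map (twist G) xs \<in> tensor_gens G n"
  by (auto simp: tensor_gens_def twist_closed)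

lemma twist_tensor: "twist (T n) = lin_ext K (T n) (\<lambda>xs. basis_vec K (map (twist G) xs))"
  unfolding F.lin_ext_free_vs[symmetric] by (simp add: free_tensor_def module.defs)

lemma twist_tensor_linear: "linear_map K (T n) (T n) (twist (T n))"
  unfolding twist_tensor
  by (rule F.lin_ext_linear) (auto intro: F.module_axioms F.basis_vec_closed map_twist_gens)

lemma twist_tensor_basis:
  "xs \<in> tensor_gens G n \<Longrightarrow> twist (T n) (basis_vec K xs) = basis_vec K (map (twist G) xs)"
  unfolding twist_tensor
  by (rule F.lin_ext_basis) (auto intro: F.module_axioms F.basis_vec_closed map_twist_gens)

lemma tensor_hom_vector_space: "hom_vector_space K (T n)"
proof -
  interpret t: linear_map K "T n" "T n" "twist (T n)" by (rule twist_tensor_linear)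
  show ?thesis
    by (intro hom_vector_space.intro hom_vector_space_axioms.intro K.field_axioms F.module_axioms
        t.map_closed t.map_add t.map_smult)
qed

lemma gens_insert_iff:
  "us @ [x] @ vs \<in> tensor_gens G n \<longleftrightarrow>
    set us \<subseteq> carrier G \<and> x \<in> carrier G \<and> set vs \<subseteq> carrier G \<and> Suc (length us + length vs) = n"
  by (auto simp: tensor_gens_def)

lemma multilin_rels_closed: "multilin_rels K G n \<subseteq> carrier (T n)"
proof
  fix r assume "r \<in> multilin_rels K G n"
  then show "r \<in> carrier (T n)"
    by cases (auto simp only: gens_insert_iff intro!: F.M.minus_closed F.M.a_closed F.smult_closed
        F.basis_vec_closed V.M.a_closed V.smult_closed)
qed

lemma tensor_ker_submodule: "submodule (N n) K (T n)"
  unfolding tensor_ker_def by (rule F.submodule_hull) (rule multilin_rels_closed)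

lemma multilin_rels_in_ker: "r \<in> multilin_rels K G n \<Longrightarrow> r \<in> N n"
  unfolding tensor_ker_def by (rule hull_inc)

lemma twist_tensor_ker: "twist (T n) ` N n \<subseteq> N n"
proof
  fix y assume "y \<in> twist (T n) ` N n"
  then obtain x where x: "x \<in> N n" and y: "y = twist (T n) x" by auto
  interpret t: linear_map K "T n" "T n" "twist (T n)" by (rule twist_tensor_linear)
  have "twist (T n) r \<in> N n" if "r \<in> multilin_rels K G n" for r
    using that
  proof cases
    case (add us x vs y)
    note g = add(2,3)[unfolded gens_insert_iff]
    have "us @ [x \<oplus>\<^bsub>G\<^esub> y] @ vs \<in> tensor_gens G n"
      using g unfolding gens_insert_iff by simp
    then have "twist (T n) r = basis_vec K (map (twist G) us @ [twist G x \<oplus>\<^bsub>G\<^esub> twist G y] @ map (twist G) vs)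
        \<ominus>\<^bsub>T n\<^esub> (basis_vec K (map (twist G) us @ [twist G x] @ map (twist G) vs)
          \<oplus>\<^bsub>T n\<^esub> basis_vec K (map (twist G) us @ [twist G y] @ map (twist G) vs))"
      using add(2,3) g unfolding add(1)
      by (simp add: t.map_minus t.map_add F.basis_vec_closed twist_tensor_basis twist_add)
    also have "\<dots> \<in> N n"
      using g by (intro multilin_rels_in_ker multilin_rels.add) (auto simp: tensor_gens_def twist_closed)
    finally show ?thesis .
  next
    case (smult us x vs c)
    note g = smult(2)[unfolded gens_insert_iff]
    have "us @ [c \<odot>\<^bsub>G\<^esub> x] @ vs \<in> tensor_gens G n"
      using g smult(3) unfolding gens_insert_iff by simp
    then have "twist (T n) r = basis_vec K (map (twist G) us @ [c \<odot>\<^bsub>G\<^esub> twist G x] @ map (twist G) vs)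
        \<ominus>\<^bsub>T n\<^esub> (c \<odot>\<^bsub>T n\<^esub> basis_vec K (map (twist G) us @ [twist G x] @ map (twist G) vs))"
      using smult(2,3) g unfolding smult(1)
      by (simp add: t.map_minus t.map_smult F.basis_vec_closed twist_tensor_basis twist_smult)
    also have "\<dots> \<in> N n"
      using g smult(3)
      by (intro multilin_rels_in_ker multilin_rels.smult) (auto simp: tensor_gens_def twist_closed)
    finally show ?thesis .
  qed
  then show "y \<in> N n"
    using t.map_hull_subset[OF tensor_ker_submodule multilin_rels_closed] x
    unfolding y tensor_ker_def by blast
qed

lemma hom_quotient_tensor: "hom_quotient K (T n) (N n)"
  by (intro hom_quotient.intro hom_quotient_axioms.intro tensor_hom_vector_space
      tensor_ker_submodule twist_tensor_ker)

sublocale C: hom_quotient K "T n" "N n" for n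
  by (rule hom_quotient_tensor)

lemma CL_eq: "CL K G n = C.quot n"
  by (simp add: CL_def)

lemma pure_closed: "xs \<in> tensor_gens G n \<Longrightarrow> pure n xs \<in> carrier (CL K G n)"
  unfolding CL_eq by (rule C.cls.map_closed) (rule F.basis_vec_closed)

lemma pure_add:
  assumes "us @ [x] @ vs \<in> tensor_gens G n" "us @ [y] @ vs \<in> tensor_gens G n"
  shows "pure n (us @ [x \<oplus>\<^bsub>G\<^esub> y] @ vs) = pure n (us @ [x] @ vs) \<oplus>\<^bsub>CL K G n\<^esub> pure n (us @ [y] @ vs)"
proof -
  note b = assms[THEN F.basis_vec_closed]
  have "us @ [x \<oplus>\<^bsub>G\<^esub> y] @ vs \<in> tensor_gens G n"
    using assms unfolding gens_insert_iff by simp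
  then show ?thesis
    using F.coset_eq_iff[OF tensor_ker_submodule, THEN iffD2, OF _ _ multilin_rels_in_ker[OF multilin_rels.add[OF assms]]] b
    unfolding CL_eq C.cls.map_add[OF b, symmetric]
    by (meson F.M.a_closed F.basis_vec_closed)
qed

lemma pure_smult:
  assumes "us @ [x] @ vs \<in> tensor_gens G n" "c \<in> carrier K"
  shows "pure n (us @ [c \<odot>\<^bsub>G\<^esub> x] @ vs) = c \<odot>\<^bsub>CL K G n\<^esub> pure n (us @ [x] @ vs)"
proof -
  note b = assms(1)[THEN F.basis_vec_closed]
  have "us @ [c \<odot>\<^bsub>G\<^esub> x] @ vs \<in> tensor_gens G n"
    using assms unfolding gens_insert_iff by simp
  then show ?thesis
    using F.coset_eq_iff[OF tensor_ker_submodule, THEN iffD2, OF _ _ multilin_rels_in_ker[OF multilin_rels.smult[OF assms]]] b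
    unfolding CL_eq C.cls.map_smult[OF assms(2) b, symmetric]
    by (meson F.smult_closed F.basis_vec_closed assms(2))
qed

lemma pure_twist:
  "xs \<in> tensor_gens G n \<Longrightarrow> twist (CL K G n) (pure n xs) = pure n (map (twist G) xs)"
  unfolding CL_eq by (simp add: C.cls_twist[symmetric] F.basis_vec_closed twist_tensor_basis)

text \<open>The universal property of the tensor power: a multilinear map factors through it.\<close>

lemma multilinear_ext_kills_ker:
  assumes W: "module K W" and h: "h \<in> tensor_gens G n \<rightarrow> carrier W"
    and add: "\<And>us x y vs. \<lbrakk>us @ [x] @ vs \<in> tensor_gens G n; us @ [y] @ vs \<in> tensor_gens G n\<rbrakk>
      \<Longrightarrow> h (us @ [x \<oplus>\<^bsub>G\<^esub> y] @ vs) = h (us @ [x] @ vs) \<oplus>\<^bsub>W\<^esub> h (us @ [y] @ vs)"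
    and smult: "\<And>us x c vs. \<lbrakk>us @ [x] @ vs \<in> tensor_gens G n; c \<in> carrier K\<rbrakk>
      \<Longrightarrow> h (us @ [c \<odot>\<^bsub>G\<^esub> x] @ vs) = c \<odot>\<^bsub>W\<^esub> h (us @ [x] @ vs)"
    and f: "f \<in> N n"
  shows "lin_ext K W h f = \<zero>\<^bsub>W\<^esub>"
proof -
  interpret L: linear_map K "T n" W "lin_ext K W h" using W h by (rule F.lin_ext_linear)
  note basis = F.lin_ext_basis[OF W h]
  have hc: "h xs \<in> carrier W" if "xs \<in> tensor_gens G n" for xs using h that by auto
  have "lin_ext K W h r \<in> {\<zero>\<^bsub>W\<^esub>}" if "r \<in> multilin_rels K G n" for r
    using that
  proof cases
    case (add us x vs y)
    then have "us @ [x \<oplus>\<^bsub>G\<^esub> y] @ vs \<in> tensor_gens G n"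
      unfolding gens_insert_iff by simp
    then show ?thesis
      using add assms(3)[OF add(2,3)] hc[OF add(2)] hc[OF add(3)]
      by (simp only: L.map_minus L.map_add F.basis_vec_closed basis F.M.a_closed) (simp add: L.W.minus_eq_zero_iff)
  next
    case (smult us x vs c)
    then have "us @ [c \<odot>\<^bsub>G\<^esub> x] @ vs \<in> tensor_gens G n"
      unfolding gens_insert_iff by simp
    then show ?thesis
      using smult assms(4)[OF smult(2,3)] hc[OF smult(2)]
      by (simp only: L.map_minus L.map_smult F.basis_vec_closed basis F.smult_closed) (simp add: L.W.minus_eq_zero_iff)
  qed
  then show ?thesis
    using L.map_hull_subset[OF L.W.singleton_zero_submodule multilin_rels_closed] f
    unfolding tensor_ker_def by blast
qed

end

context leibniz
begin

lemma pair_gens: "[x, y] \<in> tensor_gens G 2 \<longleftrightarrow> x \<in> carrier G \<and> y \<in> carrier G"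
  by (auto simp: tensor_gens_def)

lemma triple_gens: "[x, y, z] \<in> tensor_gens G 3 \<longleftrightarrow> x \<in> carrier G \<and> y \<in> carrier G \<and> z \<in> carrier G"
  by (auto simp: tensor_gens_def)

lemma single_gens: "[x] \<in> tensor_gens G 1 \<longleftrightarrow> x \<in> carrier G"
  by (auto simp: tensor_gens_def)

lemma gens_1E: 
  assumes "xs \<in> tensor_gens G 1"
  obtains x where "xs = [x]" "x \<in> carrier G"
  using assms by (auto simp: tensor_gens_def length_Suc_conv)

lemma gens_2E: 
  assumes "xs \<in> tensor_gens G 2"
  obtains x y where "xs = [x, y]" "x \<in> carrier G" "y \<in> carrier G"
  using assms by (auto simp: tensor_gens_def length_Suc_conv numeral_eq_Suc)

lemma gens_3E: 
  assumes "xs \<in> tensor_gens G 3"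
  obtains x y z where "xs = [x, y, z]" "x \<in> carrier G" "y \<in> carrier G" "z \<in> carrier G"
  using assms by (auto simp: tensor_gens_def length_Suc_conv numeral_eq_Suc)

lemma insert_2_cases:
  assumes "us @ [x] @ vs \<in> tensor_gens G 2"
  obtains z where "us = []" "vs = [z]" "z \<in> carrier G"
  | z where "us = [z]" "vs = []" "z \<in> carrier G"
  using assms unfolding gens_insert_iff
  by (cases us; cases vs) (auto simp: numeral_eq_Suc)

lemma insert_3_cases:
  assumes "us @ [x] @ vs \<in> tensor_gens G 3"
  obtains y z where "us = []" "vs = [y, z]" "y \<in> carrier G" "z \<in> carrier G"
  | y z where "us = [y]" "vs = [z]" "y \<in> carrier G" "z \<in> carrier G"
  | y z where "us = [y, z]" "vs = []" "y \<in> carrier G" "z \<in> carrier G"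
proof -
  have "length us + length vs = 2" "set us \<subseteq> carrier G" "set vs \<subseteq> carrier G"
    using assms unfolding gens_insert_iff by auto
  moreover from this have "length us = 0 \<and> length vs = 2 \<or> length us = 1 \<and> length vs = 1
      \<or> length us = 2 \<and> length vs = 0" by arith
  ultimately show thesis using that
    by (auto simp: length_Suc_conv numeral_eq_Suc)
qed

lemma boundary_gen_2:
  assumes "x \<in> carrier G" "y \<in> carrier G"
  shows "boundary_gen K G 2 [x, y] = \<ominus>\<^bsub>T 1\<^esub> basis_vec K [x \<otimes>\<^bsub>G\<^esub> y]"
proof -
  have "{(i, j). 1 \<le> i \<and> i < j \<and> j \<le> (2::nat)} = {(1, 2)}" by auto
  moreover have "basis_vec K [x \<otimes>\<^bsub>G\<^esub> y] \<in> carrier (T 1)"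
    using assms by (intro F.basis_vec_closed) (simp only: single_gens bracket_closed)
  ultimately show ?thesis
    by (simp add: boundary_gen_def boundary_summand_def numeral_eq_Suc F.smult_l_minus K.l_minus)
qed

lemma boundary_gen_3:
  assumes "x \<in> carrier G" "y \<in> carrier G" "z \<in> carrier G"
  shows "boundary_gen K G 3 [x, y, z] = 
    \<ominus>\<^bsub>T 2\<^esub> basis_vec K [x \<otimes>\<^bsub>G\<^esub> y, twist G z]
    \<oplus>\<^bsub>T 2\<^esub> basis_vec K [x \<otimes>\<^bsub>G\<^esub> z, twist G y] \<oplus>\<^bsub>T 2\<^esub> basis_vec K [twist G x, y \<otimes>\<^bsub>G\<^esub> z]"
proof -
  have "{(i, j). 1 \<le> i \<and> i < j \<and> j \<le> (3::nat)} = {(1, 2), (1, 3), (2, 3)}" by auto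
  moreover have "basis_vec K [x \<otimes>\<^bsub>G\<^esub> y, twist G z] \<in> carrier (T 2)"
    "basis_vec K [x \<otimes>\<^bsub>G\<^esub> z, twist G y] \<in> carrier (T 2)"
    "basis_vec K [twist G x, y \<otimes>\<^bsub>G\<^esub> z] \<in> carrier (T 2)"
    using assms by (auto intro!: F.basis_vec_closed simp: pair_gens bracket_closed twist_closed)
  ultimately show ?thesis
    by (simp add: boundary_gen_def boundary_summand_def numeral_eq_Suc F.smult_l_minus K.l_minus
        F.M.a_assoc)
qed

text \<open>Degrees such as \<open>2 - 1\<close> are simplified to \<open>Suc 0\<close>; the form \<open>1\<close> is kept instead.\<close>

declare One_nat_def [simp del] One_nat_def [symmetric, simp]

text \<open>The boundary on formal combinations, before multilinearity is imposed.\<close>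

abbreviation "D n \<equiv> lin_ext K (T (n - 1)) (boundary_gen K G n)"

lemma boundary_gen_closed:
  "boundary_gen K G 2 \<in> tensor_gens G 2 \<rightarrow> carrier (T 1)"
  "boundary_gen K G 3 \<in> tensor_gens G 3 \<rightarrow> carrier (T 2)"
  by (auto elim!: gens_2E gens_3E simp: boundary_gen_2 boundary_gen_3 
      intro!: F.M.a_inv_closed F.M.a_closed F.basis_vec_closed)
    (auto simp: pair_gens single_gens bracket_closed twist_closed)

lemma D_linear: "linear_map K (T 2) (T 1) (D 2)" "linear_map K (T 3) (T 2) (D 3)"
  using F.lin_ext_linear[OF F.module_axioms boundary_gen_closed(1)]
    F.lin_ext_linear[OF F.module_axioms boundary_gen_closed(2)] by simp_all

lemma D_basis:
  "xs \<in> tensor_gens G 2 \<Longrightarrow> D 2 (basis_vec K xs) = boundary_gen K G 2 xs"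
  "xs \<in> tensor_gens G 3 \<Longrightarrow> D 3 (basis_vec K xs) = boundary_gen K G 3 xs"
  using F.lin_ext_basis[OF F.module_axioms boundary_gen_closed(1)]
    F.lin_ext_basis[OF F.module_axioms boundary_gen_closed(2)] by simp_all

text \<open>The class of \<open>x \<otimes> y\<close> is bilinear, and hence so are the summands of the boundary.\<close>

lemma pure_2_linear:
  "y \<in> carrier G \<Longrightarrow> linear_map K G (CL K G 2) (\<lambda>x. pure 2 [x, y])"
  "x \<in> carrier G \<Longrightarrow> linear_map K G (CL K G 2) (\<lambda>y. pure 2 [x, y])"
proof -
  have m: "module K (CL K G 2)" unfolding CL_eq by (rule C.quot.V.module_axioms)
  show "linear_map K G (CL K G 2) (\<lambda>x. pure 2 [x, y])" if "y \<in> carrier G"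
    using V.module_axioms m
  proof (rule linear_mapI)
    show "pure 2 [x, y] \<in> carrier (CL K G 2)" if "x \<in> carrier G" for x
      using \<open>y \<in> carrier G\<close> that by (intro pure_closed) (simp add: pair_gens)
    show "pure 2 [a \<oplus>\<^bsub>G\<^esub> b, y] = pure 2 [a, y] \<oplus>\<^bsub>CL K G 2\<^esub> pure 2 [b, y]"
      if "a \<in> carrier G" "b \<in> carrier G" for a b
      using pure_add[of "[]" a "[y]" 2 b] that \<open>y \<in> carrier G\<close> by (simp add: pair_gens)
    show "pure 2 [c \<odot>\<^bsub>G\<^esub> a, y] = c \<odot>\<^bsub>CL K G 2\<^esub> pure 2 [a, y]"
      if "c \<in> carrier K" "a \<in> carrier G" for c a
      using pure_smult[of "[]" a "[y]" 2 c] that \<open>y \<in> carrier G\<close> by (simp add: pair_gens)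
  qed
  show "linear_map K G (CL K G 2) (\<lambda>y. pure 2 [x, y])" if "x \<in> carrier G"
    using V.module_axioms m
  proof (rule linear_mapI)
    show "pure 2 [x, y] \<in> carrier (CL K G 2)" if "y \<in> carrier G" for y
      using \<open>x \<in> carrier G\<close> that by (intro pure_closed) (simp add: pair_gens)
    show "pure 2 [x, a \<oplus>\<^bsub>G\<^esub> b] = pure 2 [x, a] \<oplus>\<^bsub>CL K G 2\<^esub> pure 2 [x, b]"
      if "a \<in> carrier G" "b \<in> carrier G" for a b
      using pure_add[of "[x]" a "[]" 2 b] that \<open>x \<in> carrier G\<close> by (simp add: pair_gens)
    show "pure 2 [x, c \<odot>\<^bsub>G\<^esub> a] = c \<odot>\<^bsub>CL K G 2\<^esub> pure 2 [x, a]"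
      if "c \<in> carrier K" "a \<in> carrier G" for c a
      using pure_smult[of "[x]" a "[]" 2 c] that \<open>x \<in> carrier G\<close> by (simp add: pair_gens)
  qed
qed

lemma pure_1_linear: "linear_map K G (CL K G 1) (\<lambda>x. pure 1 [x])"
proof (rule linear_mapI)
  show "module K G" by (rule V.module_axioms)
  show "module K (CL K G 1)" unfolding CL_eq by (rule C.quot.V.module_axioms)
  show "pure 1 [x] \<in> carrier (CL K G 1)" if "x \<in> carrier G" for x
    using that by (intro pure_closed) (simp only: single_gens)
  show "pure 1 [a \<oplus>\<^bsub>G\<^esub> b] = pure 1 [a] \<oplus>\<^bsub>CL K G 1\<^esub> pure 1 [b]"
    if "a \<in> carrier G" "b \<in> carrier G" for a b
    using pure_add[of "[]" a "[]" 1 b] that by (simp add: single_gens)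
  show "pure 1 [c \<odot>\<^bsub>G\<^esub> a] = c \<odot>\<^bsub>CL K G 1\<^esub> pure 1 [a]"
    if "c \<in> carrier K" "a \<in> carrier G" for c a
    using pure_smult[of "[]" a "[]" 1 c] that by (simp add: single_gens)
qed

abbreviation "boundary_cls n xs \<equiv> N (n - 1) +>\<^bsub>T (n - 1)\<^esub> boundary_gen K G n xs"

text \<open>If the class of the boundary is multilinear in the arguments, the boundary respects the
  multilinearity relations and so descends to the tensor powers.\<close>

lemma D_ker:
  assumes "n = 2 \<or> n = 3"
    and multilinear: 
     "\<And>us x y vs. \<lbrakk>us @ [x] @ vs \<in> tensor_gens G n; us @ [y] @ vs \<in> tensor_gens G n\<rbrakk>
      \<Longrightarrow> boundary_cls n (us @ [x \<oplus>\<^bsub>G\<^esub> y] @ vs) = 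
         boundary_cls n (us @ [x] @ vs)
         \<oplus>\<^bsub>CL K G (n - 1)\<^esub> boundary_cls n (us @ [y] @ vs)"
     "\<And>us x c vs. \<lbrakk>us @ [x] @ vs \<in> tensor_gens G n; c \<in> carrier K\<rbrakk>
      \<Longrightarrow> boundary_cls n (us @ [c \<odot>\<^bsub>G\<^esub> x] @ vs) = 
         c \<odot>\<^bsub>CL K G (n - 1)\<^esub> boundary_cls n (us @ [x] @ vs)"
    and f: "f \<in> N n"
  shows "D n f \<in> N (n - 1)"
proof -
  let ?h = "\<lambda>xs. boundary_cls n xs"
  have gen: "boundary_gen K G n \<in> tensor_gens G n \<rightarrow> carrier (T (n - 1))"
    using assms(1) boundary_gen_closed by auto
  have lin: "linear_map K (T n) (T (n - 1)) (D n)"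
    using assms(1) D_linear by auto
  have W: "module K (CL K G (n - 1))" unfolding CL_eq by (rule C.quot.V.module_axioms)
  have h: "?h \<in> tensor_gens G n \<rightarrow> carrier (CL K G (n - 1))"
    unfolding CL_eq using gen C.cls.map_closed by blast
  have fT: "f \<in> carrier (T n)" using f F.submoduleE(1)[OF tensor_ker_submodule] by auto
  have "N (n-1) +>\<^bsub>T (n-1)\<^esub> D n f = lin_ext K (CL K G (n - 1)) ?h f"
  proof (rule F.linear_eqI[OF _ _ _ fT])
    show "linear_map K (T n) (CL K G (n - 1)) (\<lambda>f. N (n-1) +>\<^bsub>T (n-1)\<^esub> D n f)"
      using lin C.cls.linear_map_axioms unfolding CL_eq by (rule linear_map_comp)
    show "linear_map K (T n) (CL K G (n - 1)) (lin_ext K (CL K G (n - 1)) ?h)"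
      using W h by (rule F.lin_ext_linear)
    show "N (n-1) +>\<^bsub>T (n-1)\<^esub> D n (basis_vec K xs) = lin_ext K (CL K G (n - 1)) ?h (basis_vec K xs)"
      if "xs \<in> tensor_gens G n" for xs
      using F.lin_ext_basis[OF W h that] F.lin_ext_basis[OF F.module_axioms gen that] by simp
  qed
  also have "\<dots> = \<zero>\<^bsub>CL K G (n - 1)\<^esub>"
    using W h multilinear f by (rule multilinear_ext_kills_ker)
  finally show ?thesis
    unfolding CL_eq using C.cls_eq_zero_iff linear_map.map_closed[OF lin fT] by blast
qed

lemma cls_boundary_gen_2:
  assumes "x \<in> carrier G" "y \<in> carrier G"
  shows "N 1 +>\<^bsub>T 1\<^esub> boundary_gen K G 2 [x, y] = \<ominus>\<^bsub>CL K G 1\<^esub> pure 1 [x \<otimes>\<^bsub>G\<^esub> y]"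
proof -
  have "basis_vec K [x \<otimes>\<^bsub>G\<^esub> y] \<in> carrier (T 1)"
    using assms by (intro F.basis_vec_closed) (simp only: single_gens bracket_closed)
  then show ?thesis
    unfolding boundary_gen_2[OF assms] CL_eq by (rule C.cls.map_a_inv)
qed

lemma cls_boundary_gen_3:
  assumes "x \<in> carrier G" "y \<in> carrier G" "z \<in> carrier G"
  shows "N 2 +>\<^bsub>T 2\<^esub> boundary_gen K G 3 [x, y, z] = 
    \<ominus>\<^bsub>CL K G 2\<^esub> pure 2 [x \<otimes>\<^bsub>G\<^esub> y, twist G z]
    \<oplus>\<^bsub>CL K G 2\<^esub> pure 2 [x \<otimes>\<^bsub>G\<^esub> z, twist G y] \<oplus>\<^bsub>CL K G 2\<^esub> pure 2 [twist G x, y \<otimes>\<^bsub>G\<^esub> z]"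
proof -
  have "basis_vec K [x \<otimes>\<^bsub>G\<^esub> y, twist G z] \<in> carrier (T 2)"
    "basis_vec K [x \<otimes>\<^bsub>G\<^esub> z, twist G y] \<in> carrier (T 2)"
    "basis_vec K [twist G x, y \<otimes>\<^bsub>G\<^esub> z] \<in> carrier (T 2)"
    using assms by (auto intro!: F.basis_vec_closed simp: pair_gens bracket_closed twist_closed)
  then show ?thesis
    unfolding boundary_gen_3[OF assms] CL_eq by (simp add: C.cls.map_add C.cls.map_a_inv)
qed

lemma D_2_ker:
  assumes "f \<in> N 2"
  shows "D 2 f \<in> N 1"
proof -
  interpret p: linear_map K G "CL K G 1" "\<lambda>x. pure 1 [x]" by (rule pure_1_linear)
  have "D 2 f \<in> N (2 - 1)"
  proof (rule D_ker)
    fix us x y vs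
    assume xy: "us @ [x] @ vs \<in> tensor_gens G 2" "us @ [y] @ vs \<in> tensor_gens G 2"
    then have c: "x \<in> carrier G" "y \<in> carrier G" by (simp_all only: gens_insert_iff)
    show "boundary_cls 2 (us @ [x \<oplus>\<^bsub>G\<^esub> y] @ vs) = 
         boundary_cls 2 (us @ [x] @ vs)
         \<oplus>\<^bsub>CL K G (2 - 1)\<^esub> boundary_cls 2 (us @ [y] @ vs)"
      using xy(1) c by (cases rule: insert_2_cases)
        (simp_all add: cls_boundary_gen_2 bracket_add_left bracket_add_right bracket_closed
          p.map_add p.map_closed p.W.M.minus_add)
  next
    fix us x c vs
    assume xy: "us @ [x] @ vs \<in> tensor_gens G 2" and c: "c \<in> carrier K"
    then have x: "x \<in> carrier G" by (simp_all only: gens_insert_iff)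
    show "boundary_cls 2 (us @ [c \<odot>\<^bsub>G\<^esub> x] @ vs) = 
         c \<odot>\<^bsub>CL K G (2 - 1)\<^esub> boundary_cls 2 (us @ [x] @ vs)"
      using xy c x by (cases rule: insert_2_cases)
        (simp_all add: cls_boundary_gen_2 bracket_smult_left bracket_smult_right bracket_closed
          p.map_smult p.map_closed p.W.smult_r_minus)
  qed (use assms in auto)
  then show ?thesis by simp
qed

lemma D_3_ker:
  assumes "f \<in> N 3"
  shows "D 3 f \<in> N 2"
proof -
  let ?t = "\<lambda>x y. pure 2 [x, y]"
  have m: "module K (CL K G 2)" unfolding CL_eq by (rule C.quot.V.module_axioms)
  interpret W: module K "CL K G 2" by (rule m)
  note t = linear_map.map_add[OF pure_2_linear(1)] linear_map.map_add[OF pure_2_linear(2)]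
    linear_map.map_smult[OF pure_2_linear(1)] linear_map.map_smult[OF pure_2_linear(2)]
    linear_map.map_closed[OF pure_2_linear(1)]
  have "D 3 f \<in> N (3 - 1)"
  proof (rule D_ker)
    fix us x y vs
    assume xy: "us @ [x] @ vs \<in> tensor_gens G 3" "us @ [y] @ vs \<in> tensor_gens G 3"
    then have c: "x \<in> carrier G" "y \<in> carrier G" by (simp_all only: gens_insert_iff)
    show "boundary_cls 3 (us @ [x \<oplus>\<^bsub>G\<^esub> y] @ vs) = 
         boundary_cls 3 (us @ [x] @ vs)
         \<oplus>\<^bsub>CL K G (3 - 1)\<^esub> boundary_cls 3 (us @ [y] @ vs)"
      using xy(1) c by (cases rule: insert_3_cases)
        (simp_all add: cls_boundary_gen_3 bracket_add_left bracket_add_right bracket_closed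
          twist_closed twist_add t W.M.minus_add W.M.a_ac)
  next
    fix us x c vs
    assume xy: "us @ [x] @ vs \<in> tensor_gens G 3" and c: "c \<in> carrier K"
    then have x: "x \<in> carrier G" by (simp_all only: gens_insert_iff)
    show "boundary_cls 3 (us @ [c \<odot>\<^bsub>G\<^esub> x] @ vs) = 
         c \<odot>\<^bsub>CL K G (3 - 1)\<^esub> boundary_cls 3 (us @ [x] @ vs)"
      using xy c x by (cases rule: insert_3_cases)
        (simp_all add: cls_boundary_gen_3 bracket_smult_left bracket_smult_right bracket_closed
          twist_closed twist_smult t W.smult_r_minus W.smult_r_distr)
  qed (use assms in auto)
  then show ?thesis by simp
qed

lemma boundary_2_cls:
  "f \<in> carrier (T 2) \<Longrightarrow> boundary K G 2 (N 2 +>\<^bsub>T 2\<^esub> f) = N 1 +>\<^bsub>T 1\<^esub> D 2 f"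
  using linear_map.quot_map_coset[OF D_linear(1) tensor_ker_submodule tensor_ker_submodule] D_2_ker
  by (auto simp: boundary_def)

lemma boundary_3_cls:
  "f \<in> carrier (T 3) \<Longrightarrow> boundary K G 3 (N 3 +>\<^bsub>T 3\<^esub> f) = N 2 +>\<^bsub>T 2\<^esub> D 3 f"
  using linear_map.quot_map_coset[OF D_linear(2) tensor_ker_submodule tensor_ker_submodule] D_3_ker
  by (auto simp: boundary_def)

abbreviation "boundaries \<equiv> boundary K G 3 ` carrier (CL K G 3)"

lemma boundaries_eq: "boundaries = (\<lambda>f. N 2 +>\<^bsub>T 2\<^esub> D 3 f) ` carrier (T 3)"
  unfolding CL_eq C.carrier_quot image_image by (intro image_cong refl boundary_3_cls)

lemma D_3_twist:
  assumes "f \<in> carrier (T 3)"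
  shows "twist (T 2) (D 3 f) = D 3 (twist (T 3) f)"
proof (rule F.linear_eqI[OF _ _ _ assms])
  interpret t: linear_map K "T 2" "T 2" "twist (T 2)" by (rule twist_tensor_linear)
  show "linear_map K (T 3) (T 2) (\<lambda>f. twist (T 2) (D 3 f))"
    using D_linear(2) twist_tensor_linear by (rule linear_map_comp)
  show "linear_map K (T 3) (T 2) (\<lambda>f. D 3 (twist (T 3) f))"
    using twist_tensor_linear D_linear(2) by (rule linear_map_comp)
  fix xs assume xs: "xs \<in> tensor_gens G 3"
  then obtain x y z where xyz: "xs = [x, y, z]" "x \<in> carrier G" "y \<in> carrier G" "z \<in> carrier G"
    by (rule gens_3E)
  have "[x \<otimes>\<^bsub>G\<^esub> y, twist G z] \<in> tensor_gens G 2" "[x \<otimes>\<^bsub>G\<^esub> z, twist G y] \<in> tensor_gens G 2"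
    "[twist G x, y \<otimes>\<^bsub>G\<^esub> z] \<in> tensor_gens G 2"
    using xyz by (simp_all add: pair_gens bracket_closed twist_closed)
  then show "twist (T 2) (D 3 (basis_vec K xs)) = D 3 (twist (T 3) (basis_vec K xs))"
    unfolding twist_tensor_basis[OF xs] D_basis(2)[OF xs] D_basis(2)[OF map_twist_gens[OF xs]]
    using xyz by (simp add: boundary_gen_3 twist_closed twist_bracket twist_tensor_basis t.map_add
        t.map_a_inv F.basis_vec_closed)
qed

lemma hom_quotient_boundaries: "hom_quotient K (CL K G 2) boundaries"
proof (intro hom_quotient.intro hom_quotient_axioms.intro)
  show "hom_vector_space K (CL K G 2)" unfolding CL_eq by (rule C.quot_hom_vector_space)
  have lin: "linear_map K (T 3) (CL K G 2) (\<lambda>f. N 2 +>\<^bsub>T 2\<^esub> D 3 f)"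
    unfolding CL_eq using D_linear(2) C.cls.linear_map_axioms by (rule linear_map_comp)
  show "submodule boundaries K (CL K G 2)"
    unfolding boundaries_eq by (rule linear_map.image_submodule[OF lin F.carrier_is_submodule])
  have "twist (CL K G 2) (N 2 +>\<^bsub>T 2\<^esub> D 3 f) = N 2 +>\<^bsub>T 2\<^esub> D 3 (twist (T 3) f)"
    if "f \<in> carrier (T 3)" for f
    using that unfolding D_3_twist[OF that, symmetric] CL_eq
    using C.cls_twist[OF linear_map.map_closed[OF D_linear(2) that]] by simp
  then show "twist (CL K G 2) ` boundaries \<subseteq> boundaries"
    unfolding boundaries_eq using linear_map.map_closed[OF twist_tensor_linear] by auto
qed

sublocale Q: hom_quotient K "CL K G 2" boundaries
  by (rule hom_quotient_boundaries)

abbreviation "tensor_cls f \<equiv> boundaries +>\<^bsub>CL K G 2\<^esub> (N 2 +>\<^bsub>T 2\<^esub> f)"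

lemma tensor_cls_linear: "linear_map K (T 2) Q.quot tensor_cls"
  using C.cls.linear_map_axioms[of 2] Q.cls.linear_map_axioms unfolding CL_eq by (rule linear_map_comp)

lemma tensor_cls_twist: "f \<in> carrier (T 2) \<Longrightarrow> tensor_cls (twist (T 2) f) = twist Q.quot (tensor_cls f)"
  using C.cls_twist[of f 2] Q.cls_twist[of "N 2 +>\<^bsub>T 2\<^esub> f"] C.cls.map_closed[of f 2]
  unfolding CL_eq by simp

text \<open>The Hom-Leibniz identity for classes says exactly that the boundary of \<open>x \<otimes> y \<otimes> z\<close> vanishes in
  the cokernel.\<close>

lemma tensor_cls_pairing: "leibniz_pairing K G Q.quot (\<lambda>x y. tensor_cls (basis_vec K [x, y]))"
proof (intro leibniz_pairing.intro leibniz_pairing_axioms.intro leibniz_axioms Q.quot_hom_vector_space)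
  show "linear_map K G Q.quot (\<lambda>x. tensor_cls (basis_vec K [x, y]))" if "y \<in> carrier G" for y
    using pure_2_linear(1)[OF that] Q.cls.linear_map_axioms by (rule linear_map_comp)
  show "linear_map K G Q.quot (\<lambda>y. tensor_cls (basis_vec K [x, y]))" if "x \<in> carrier G" for x
    using pure_2_linear(2)[OF that] Q.cls.linear_map_axioms by (rule linear_map_comp)
next
  fix x y z assume xyz: "x \<in> carrier G" "y \<in> carrier G" "z \<in> carrier G"
  let ?a = "tensor_cls (basis_vec K [twist G x, y \<otimes>\<^bsub>G\<^esub> z])"
    and ?b = "tensor_cls (basis_vec K [x \<otimes>\<^bsub>G\<^esub> y, twist G z])"
    and ?c = "tensor_cls (basis_vec K [x \<otimes>\<^bsub>G\<^esub> z, twist G y])"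
  have p: "pure 2 [x \<otimes>\<^bsub>G\<^esub> y, twist G z] \<in> carrier (CL K G 2)"
    "pure 2 [x \<otimes>\<^bsub>G\<^esub> z, twist G y] \<in> carrier (CL K G 2)"
    "pure 2 [twist G x, y \<otimes>\<^bsub>G\<^esub> z] \<in> carrier (CL K G 2)"
    using xyz by (auto intro!: pure_closed simp: pair_gens bracket_closed twist_closed)
  have abc: "?a \<in> carrier Q.quot" "?b \<in> carrier Q.quot" "?c \<in> carrier Q.quot"
    using p by (simp_all add: Q.cls.map_closed)
  have xs: "[x, y, z] \<in> tensor_gens G 3" using xyz by (simp add: triple_gens)
  have "N 2 +>\<^bsub>T 2\<^esub> boundary_gen K G 3 [x, y, z] \<in> boundaries"
    unfolding boundaries_eq D_basis(2)[OF xs, symmetric] using F.basis_vec_closed[OF xs] by blast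
  then have "boundaries +>\<^bsub>CL K G 2\<^esub> (N 2 +>\<^bsub>T 2\<^esub> boundary_gen K G 3 [x, y, z]) = \<zero>\<^bsub>Q.quot\<^esub>"
    using Q.cls_eq_zero_iff Q.V.submoduleE(1)[OF Q.submod] by blast
  then have "\<ominus>\<^bsub>Q.quot\<^esub> ?b \<oplus>\<^bsub>Q.quot\<^esub> ?c \<oplus>\<^bsub>Q.quot\<^esub> ?a = \<zero>\<^bsub>Q.quot\<^esub>"
    unfolding cls_boundary_gen_3[OF xyz] using p by (simp add: Q.cls.map_add Q.cls.map_a_inv)
  then have "?a = \<ominus>\<^bsub>Q.quot\<^esub> (\<ominus>\<^bsub>Q.quot\<^esub> ?b \<oplus>\<^bsub>Q.quot\<^esub> ?c)"
    using abc by (metis Q.quot.V.M.a_closed Q.quot.V.M.a_comm Q.quot.V.M.a_inv_closed Q.quot.V.M.minus_equality)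
  also have "\<dots> = ?b \<ominus>\<^bsub>Q.quot\<^esub> ?c"
    using abc by (simp add: a_minus_def Q.quot.V.M.minus_add)
  finally show "?a = ?b \<ominus>\<^bsub>Q.quot\<^esub> ?c" .
next
  fix x y assume xy: "x \<in> carrier G" "y \<in> carrier G"
  then have g: "[x, y] \<in> tensor_gens G 2" by (simp add: pair_gens)
  show "twist Q.quot (tensor_cls (basis_vec K [x, y])) = tensor_cls (basis_vec K [twist G x, twist G y])"
    using Q.cls_twist[OF pure_closed[OF g]] pure_twist[OF g] by simp
qed

end

text \<open>In the other direction, a Leibniz pairing gives a linear map on the tensor square that vanishes
  on the boundaries.\<close>

context leibniz_pairing
begin

abbreviation "tensor_map \<equiv> lin_ext K W (\<lambda>xs. \<tau> (hd xs) (last xs))"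

lemma tensor_gen_closed: "(\<lambda>xs. \<tau> (hd xs) (last xs)) \<in> tensor_gens G 2 \<rightarrow> carrier W"
  by (auto elim!: gens_2E simp: pair_closed)

sublocale tensor: linear_map K "T 2" W tensor_map
  by (rule F.lin_ext_linear[OF W.V.module_axioms tensor_gen_closed])

lemma tensor_map_basis:
  "\<lbrakk>x \<in> carrier G; y \<in> carrier G\<rbrakk> \<Longrightarrow> tensor_map (basis_vec K [x, y]) = \<tau> x y"
  using F.lin_ext_basis[OF W.V.module_axioms tensor_gen_closed, of "[x, y]"] by (simp add: pair_gens)

lemma tensor_map_ker:
  assumes "f \<in> N 2"
  shows "tensor_map f = \<zero>\<^bsub>W\<^esub>"
proof (rule multilinear_ext_kills_ker[OF W.V.module_axioms tensor_gen_closed _ _ assms])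
  fix us x y vs assume xy: "us @ [x] @ vs \<in> tensor_gens G 2" "us @ [y] @ vs \<in> tensor_gens G 2"
  then have c: "x \<in> carrier G" "y \<in> carrier G" by (simp_all only: gens_insert_iff)
  let ?h = "\<lambda>xs. \<tau> (hd xs) (last xs)"
  show "?h (us @ [x \<oplus>\<^bsub>G\<^esub> y] @ vs) = ?h (us @ [x] @ vs) \<oplus>\<^bsub>W\<^esub> ?h (us @ [y] @ vs)"
    using xy(1) c by (cases rule: insert_2_cases) (simp_all add: pair_add_left pair_add_right)
next
  fix us x c vs assume xc: "us @ [x] @ vs \<in> tensor_gens G 2" "c \<in> carrier K"
  then have c: "x \<in> carrier G" by (simp_all only: gens_insert_iff)
  let ?h = "\<lambda>xs. \<tau> (hd xs) (last xs)"
  show "?h (us @ [c \<odot>\<^bsub>G\<^esub> x] @ vs) = c \<odot>\<^bsub>W\<^esub> ?h (us @ [x] @ vs)"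
    using xc c by (cases rule: insert_2_cases) (simp_all add: pair_smult_left pair_smult_right)
qed

lemma tensor_map_boundary:
  assumes "f \<in> carrier (T 3)"
  shows "tensor_map (D 3 f) = \<zero>\<^bsub>W\<^esub>"
proof (rule F.linear_eqI[where f = "\<lambda>f. tensor_map (D 3 f)" and g = "\<lambda>_. \<zero>\<^bsub>W\<^esub>", OF _ _ _ assms])
  show "linear_map K (T 3) W (\<lambda>f. tensor_map (D 3 f))"
    using D_linear(2) tensor.linear_map_axioms by (rule linear_map_comp)
  show "linear_map K (T 3) W (\<lambda>_. \<zero>\<^bsub>W\<^esub>)"
    by (rule linear_mapI[OF F.module_axioms W.V.module_axioms]) auto
  fix xs assume xs: "xs \<in> tensor_gens G 3"
  then obtain x y z where xyz: "xs = [x, y, z]" "x \<in> carrier G" "y \<in> carrier G" "z \<in> carrier G"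
    by (rule gens_3E)
  have "[x \<otimes>\<^bsub>G\<^esub> y, twist G z] \<in> tensor_gens G 2" "[x \<otimes>\<^bsub>G\<^esub> z, twist G y] \<in> tensor_gens G 2"
    "[twist G x, y \<otimes>\<^bsub>G\<^esub> z] \<in> tensor_gens G 2"
    using xyz by (simp_all add: pair_gens bracket_closed twist_closed)
  then have "tensor_map (D 3 (basis_vec K xs)) = \<ominus>\<^bsub>W\<^esub> \<tau> (x \<otimes>\<^bsub>G\<^esub> y) (twist G z)
      \<oplus>\<^bsub>W\<^esub> \<tau> (x \<otimes>\<^bsub>G\<^esub> z) (twist G y) \<oplus>\<^bsub>W\<^esub> \<tau> (twist G x) (y \<otimes>\<^bsub>G\<^esub> z)"
    unfolding D_basis(2)[OF xs] using xyz
    by (simp add: boundary_gen_3 tensor.map_add tensor.map_a_inv F.basis_vec_closed tensor_map_basis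
        bracket_closed twist_closed)
  also have "\<dots> = \<zero>\<^bsub>W\<^esub>"
    using xyz by (simp add: pair_leibniz pair_closed bracket_closed twist_closed a_minus_def
        W.V.M.a_ac W.V.M.r_neg W.V.M.r_neg1 W.V.M.r_neg2)
  finally show "tensor_map (D 3 (basis_vec K xs)) = \<zero>\<^bsub>W\<^esub>" .
qed

lemma tensor_map_twist:
  assumes "f \<in> carrier (T 2)"
  shows "tensor_map (twist (T 2) f) = twist W (tensor_map f)"
proof (rule F.linear_eqI[OF _ _ _ assms])
  show "linear_map K (T 2) W (\<lambda>f. tensor_map (twist (T 2) f))"
    using twist_tensor_linear tensor.linear_map_axioms by (rule linear_map_comp)
  show "linear_map K (T 2) W (\<lambda>f. twist W (tensor_map f))"
    using tensor.linear_map_axioms W.twist_linear by (rule linear_map_comp)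
  fix xs assume xs: "xs \<in> tensor_gens G 2"
  then obtain x y where "xs = [x, y]" "x \<in> carrier G" "y \<in> carrier G"
    by (rule gens_2E)
  then show "tensor_map (twist (T 2) (basis_vec K xs)) = twist W (tensor_map (basis_vec K xs))"
    unfolding twist_tensor_basis[OF xs] by (simp add: tensor_map_basis pair_twist twist_closed)
qed

end

text \<open>In degree one \<open>CL\<^sub>1\<close> is \<open>G\<close> itself, and the boundary into it is minus the bracket.\<close>

context leibniz
begin

sublocale bracket: leibniz_pairing K G G "mult G"
  by (rule bracket_pairing)

lemma hd_closed: "hd \<in> tensor_gens G 1 \<rightarrow> carrier G"
  by (auto elim!: gens_1E)

text \<open>The list \<open>[x]\<close> stands for \<open>x\<close>: a combination of such lists is congruent, modulo the linearity
  relations, to the single list whose entry is the combination evaluated in \<open>G\<close>.\<close>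

lemma mem_ker_1_iff:
  assumes "f \<in> carrier (T 1)"
  shows "f \<in> N 1 \<longleftrightarrow> lin_ext K G hd f = \<zero>\<^bsub>G\<^esub>"
proof
  assume "f \<in> N 1"
  then show "lin_ext K G hd f = \<zero>\<^bsub>G\<^esub>"
  proof (rule multilinear_ext_kills_ker[OF V.module_axioms hd_closed, rotated 2])
    show "hd (us @ [x \<oplus>\<^bsub>G\<^esub> y] @ vs) = hd (us @ [x] @ vs) \<oplus>\<^bsub>G\<^esub> hd (us @ [y] @ vs)"
      if "us @ [x] @ vs \<in> tensor_gens G 1" for us x y vs
      using that unfolding gens_insert_iff by simp
    show "hd (us @ [c \<odot>\<^bsub>G\<^esub> x] @ vs) = c \<odot>\<^bsub>G\<^esub> hd (us @ [x] @ vs)"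
      if "us @ [x] @ vs \<in> tensor_gens G 1" for us x c vs
      using that unfolding gens_insert_iff by simp
  qed
next
  interpret p: linear_map K G "CL K G 1" "\<lambda>x. pure 1 [x]" by (rule pure_1_linear)
  assume "lin_ext K G hd f = \<zero>\<^bsub>G\<^esub>"
  moreover have "N 1 +>\<^bsub>T 1\<^esub> f = pure 1 [lin_ext K G hd f]"
  proof (rule F.linear_eqI[OF _ _ _ assms])
    show "linear_map K (T 1) (CL K G 1) (\<lambda>f. N 1 +>\<^bsub>T 1\<^esub> f)"
      unfolding CL_eq by (rule C.cls.linear_map_axioms)
    show "linear_map K (T 1) (CL K G 1) (\<lambda>f. pure 1 [lin_ext K G hd f])"
      using F.lin_ext_linear[OF V.module_axioms hd_closed] pure_1_linear by (rule linear_map_comp)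
    show "pure 1 xs = pure 1 [lin_ext K G hd (basis_vec K xs)]" if "xs \<in> tensor_gens G 1" for xs
      using that F.lin_ext_basis[OF V.module_axioms hd_closed that] by (auto elim!: gens_1E)
  qed
  ultimately show "f \<in> N 1"
    using assms C.cls_eq_zero_iff p.map_zero unfolding CL_eq by metis
qed

lemma D_2_mem_ker_iff:
  assumes "f \<in> carrier (T 2)"
  shows "D 2 f \<in> N 1 \<longleftrightarrow> bracket.tensor_map f = \<zero>\<^bsub>G\<^esub>"
proof -
  have "lin_ext K G hd (D 2 f) = \<ominus>\<^bsub>G\<^esub> bracket.tensor_map f"
  proof (rule F.linear_eqI[OF _ _ _ assms])
    note hd = F.lin_ext_linear[OF V.module_axioms hd_closed]
    interpret hd: linear_map K "T 1" G "lin_ext K G hd" by (rule hd)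
    show "linear_map K (T 2) G (\<lambda>f. lin_ext K G hd (D 2 f))"
      using D_linear(1) hd by (rule linear_map_comp)
    show "linear_map K (T 2) G (\<lambda>f. \<ominus>\<^bsub>G\<^esub> bracket.tensor_map f)"
      using bracket.tensor.linear_map_axioms by (rule linear_map_uminus)
    fix xs assume xs: "xs \<in> tensor_gens G 2"
    then obtain x y where xy: "xs = [x, y]" "x \<in> carrier G" "y \<in> carrier G"
      by (rule gens_2E)
    have g: "[x \<otimes>\<^bsub>G\<^esub> y] \<in> tensor_gens G 1" using xy by (simp only: single_gens bracket_closed)
    have "lin_ext K G hd (D 2 (basis_vec K xs)) = \<ominus>\<^bsub>G\<^esub> (x \<otimes>\<^bsub>G\<^esub> y)"
      unfolding D_basis(1)[OF xs] unfolding xy(1) boundary_gen_2[OF xy(2,3)]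
      using hd.map_a_inv[OF F.basis_vec_closed[OF g]] F.lin_ext_basis[OF V.module_axioms hd_closed g] by simp
    then show "lin_ext K G hd (D 2 (basis_vec K xs)) = \<ominus>\<^bsub>G\<^esub> bracket.tensor_map (basis_vec K xs)"
      using xy by (simp add: bracket.tensor_map_basis)
  qed
  then show ?thesis
    using mem_ker_1_iff[OF linear_map.map_closed[OF D_linear(1) assms]] bracket.tensor.map_closed[OF assms]
    by (simp add: V.a_inv_eq_zero_iff)
qed

end

section \<open>The exterior product\<close>

context leibniz
begin

abbreviation "A \<equiv> free_ext_alg K G"
abbreviation "terms \<equiv> {t. set_ext_term t \<subseteq> carrier G}"
abbreviation "I \<equiv> ext_ideal K G"

lemma free_space_terms: "free_space K terms A"
  by (intro free_space.intro free_space_axioms.intro K.field_axioms)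
    (simp_all add: free_ext_alg_def Let_def module.defs free_vs_def)

sublocale A: free_space K terms A
  by (rule free_space_terms)

lemma A_module: "module K A"
  by (rule A.module_axioms)

lemma twist_A: "twist A = lin_ext K A (\<lambda>t. basis_vec K (Twist t))"
  unfolding A.lin_ext_free_vs[symmetric] by (simp add: free_ext_alg_def Let_def module.defs)

lemma mult_A: "f \<otimes>\<^bsub>A\<^esub> g = lin_ext K A (\<lambda>s. lin_ext K A (\<lambda>t. basis_vec K (Brk s t)) g) f"
  unfolding A.lin_ext_free_vs[symmetric] by (simp add: free_ext_alg_def Let_def module.defs)

lemma twist_A_linear: "linear_map K A A (twist A)"
  unfolding twist_A by (rule A.lin_ext_linear) (auto intro: A.module_axioms simp: A.basis_vec_closed)

lemma twist_A_basis: "t \<in> terms \<Longrightarrow> twist A (basis_vec K t) = basis_vec K (Twist t)"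
  unfolding twist_A by (rule A.lin_ext_basis) (auto intro: A.module_axioms simp: A.basis_vec_closed)

lemma Brk_linear: "s \<in> terms \<Longrightarrow> linear_map K A A (lin_ext K A (\<lambda>t. basis_vec K (Brk s t)))"
  by (rule A.lin_ext_linear) (auto intro: A.module_axioms simp: A.basis_vec_closed)

lemma mult_A_linear_left: "g \<in> carrier A \<Longrightarrow> linear_map K A A (\<lambda>f. f \<otimes>\<^bsub>A\<^esub> g)"
  unfolding mult_A
  by (rule A.lin_ext_linear) (auto intro: A.module_axioms linear_map.map_closed[OF Brk_linear])

lemma mult_A_linear_right: "f \<in> carrier A \<Longrightarrow> linear_map K A A (\<lambda>g. f \<otimes>\<^bsub>A\<^esub> g)"
  unfolding mult_A
  by (rule A.lin_ext_linear_in_map) (auto intro: A.module_axioms Brk_linear)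

lemma mult_A_basis:
  assumes "s \<in> terms" "t \<in> terms"
  shows "basis_vec K s \<otimes>\<^bsub>A\<^esub> basis_vec K t = basis_vec K (Brk s t)"
proof -
  have "basis_vec K s \<otimes>\<^bsub>A\<^esub> basis_vec K t = lin_ext K A (\<lambda>t. basis_vec K (Brk s t)) (basis_vec K t)"
    unfolding mult_A using assms
    by (intro A.lin_ext_basis)
      (auto intro: A.module_axioms simp: A.basis_vec_closed linear_map.map_closed[OF Brk_linear])
  also have "\<dots> = basis_vec K (Brk s t)"
    using assms by (intro A.lin_ext_basis) (auto intro: A.module_axioms simp: A.basis_vec_closed)
  finally show ?thesis .
qed

lemmas mult_A_closed = linear_map.map_closed[OF mult_A_linear_left]

lemma A_hom_vector_space: "hom_vector_space K A"
proof -
  interpret t: linear_map K A A "twist A" by (rule twist_A_linear)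
  show ?thesis
    by (intro hom_vector_space.intro hom_vector_space_axioms.intro K.field_axioms A.module_axioms
        t.map_closed t.map_add t.map_smult)
qed

lemma wedge_closed: "\<lbrakk>x \<in> carrier G; y \<in> carrier G\<rbrakk> \<Longrightarrow> wedge_sym K x y \<in> carrier A"
  by (rule A.basis_vec_closed) simp

lemma ext_rel_closed:
  assumes "ext_rel K G l r"
  shows "l \<in> carrier A \<and> r \<in> carrier A"
  using assms
  by cases (auto simp only: intro!: mult_A_closed linear_map.map_closed[OF twist_A_linear] wedge_closed
      A.M.minus_closed A.M.a_inv_closed A.M.a_closed A.smult_closed bracket_closed twist_closed
      V.M.a_closed V.smult_closed)

lemma ext_rels_closed: "{l \<ominus>\<^bsub>A\<^esub> r | l r. ext_rel K G l r} \<subseteq> carrier A"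
  using ext_rel_closed by auto

lemma ideal_ext_ideal: "hom_ideal K A I"
proof -
  let ?S = "{J. hom_ideal K A J \<and> {l \<ominus>\<^bsub>A\<^esub> r | l r. ext_rel K G l r} \<subseteq> J}"
  have "hom_ideal K A (carrier A)"
    unfolding hom_ideal_def using A.carrier_is_submodule
    by (auto intro: mult_A_closed linear_map.map_closed[OF twist_A_linear])
  then have "carrier A \<in> ?S" using ext_rels_closed by simp
  then have "submodule (\<Inter>?S) K A" by (intro A.Inter_submodule) (auto simp: hom_ideal_def)
  then show ?thesis unfolding ext_ideal_def hull_def by (auto simp: hom_ideal_def)
qed

lemma ext_rel_in_ideal: "ext_rel K G l r \<Longrightarrow> l \<ominus>\<^bsub>A\<^esub> r \<in> I"
  unfolding ext_ideal_def by (rule hull_inc) blast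

lemma hom_quotient_ext: "hom_quotient K A I"
  using ideal_ext_ideal unfolding hom_ideal_def
  by (intro hom_quotient.intro hom_quotient_axioms.intro A_hom_vector_space) auto

sublocale E: hom_quotient K A I
  by (rule hom_quotient_ext)

lemma exterior_product_eq: "exterior_product K G = E.quot"
  by (simp add: exterior_product_def)

abbreviation "wedge x y \<equiv> I +>\<^bsub>A\<^esub> wedge_sym K x y"

lemma ext_rel_cls_eq: "ext_rel K G l r \<Longrightarrow> E.cls l = E.cls r"
  using A.coset_eq_iff[OF E.submod] ext_rel_closed ext_rel_in_ideal by blast

lemma wedge_mem: "\<lbrakk>x \<in> carrier G; y \<in> carrier G\<rbrakk> \<Longrightarrow> wedge x y \<in> carrier E.quot"
  by (intro E.cls.map_closed wedge_closed)

lemma wedge_pairing: "leibniz_pairing K G E.quot wedge"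
proof (intro leibniz_pairing.intro leibniz_pairing_axioms.intro leibniz_axioms E.quot_hom_vector_space)
  note w = E.cls.map_add[symmetric] E.cls.map_smult[symmetric] E.cls.map_minus[symmetric] wedge_closed
  show "linear_map K G E.quot (\<lambda>x. wedge x y)" if "y \<in> carrier G" for y
    using V.module_axioms E.quot.V.module_axioms
    by (rule linear_mapI) (use that in \<open>auto intro: wedge_mem simp: w ext_rel_cls_eq[OF ext_rel.add_left[OF refl]]
        ext_rel_cls_eq[OF ext_rel.smult_left[OF refl]]\<close>)
  show "linear_map K G E.quot (\<lambda>y. wedge x y)" if "x \<in> carrier G" for x
    using V.module_axioms E.quot.V.module_axioms
    by (rule linear_mapI) (use that in \<open>auto intro: wedge_mem simp: w ext_rel_cls_eq[OF ext_rel.add_right[OF refl]]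
        ext_rel_cls_eq[OF ext_rel.smult_right[OF refl]]\<close>)
  show "wedge (twist G x) (y \<otimes>\<^bsub>G\<^esub> z) = wedge (x \<otimes>\<^bsub>G\<^esub> y) (twist G z) \<ominus>\<^bsub>E.quot\<^esub> wedge (x \<otimes>\<^bsub>G\<^esub> z) (twist G y)"
    if "x \<in> carrier G" "y \<in> carrier G" "z \<in> carrier G" for x y z
    using ext_rel_cls_eq[OF ext_rel.wedge_bracket[OF refl that]] that
    by (simp add: w bracket_closed twist_closed)
  show "twist E.quot (wedge x y) = wedge (twist G x) (twist G y)"
    if "x \<in> carrier G" "y \<in> carrier G" for x y
    using ext_rel_cls_eq[OF ext_rel.twist_wedge[OF refl that]] that
    by (simp add: E.cls_twist wedge_closed)
qed

sublocale wedge: leibniz_pairing K G E.quot wedge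
  by (rule wedge_pairing)

lemma cls_mult_cong:
  assumes "a \<in> carrier A" "b \<in> carrier A" "a' \<in> carrier A" "b' \<in> carrier A"
    and "E.cls a = E.cls a'" "E.cls b = E.cls b'"
  shows "E.cls (a \<otimes>\<^bsub>A\<^esub> b) = E.cls (a' \<otimes>\<^bsub>A\<^esub> b')"
proof -
  have "a \<ominus>\<^bsub>A\<^esub> a' \<in> I" "b \<ominus>\<^bsub>A\<^esub> b' \<in> I"
    using assms A.coset_eq_iff[OF E.submod] by blast+
  then have "(a \<ominus>\<^bsub>A\<^esub> a') \<otimes>\<^bsub>A\<^esub> b \<in> I" "a' \<otimes>\<^bsub>A\<^esub> (b \<ominus>\<^bsub>A\<^esub> b') \<in> I"
    using ideal_ext_ideal assms unfolding hom_ideal_def by blast+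
  then have "E.cls (a \<otimes>\<^bsub>A\<^esub> b) = E.cls (a' \<otimes>\<^bsub>A\<^esub> b)" "E.cls (a' \<otimes>\<^bsub>A\<^esub> b) = E.cls (a' \<otimes>\<^bsub>A\<^esub> b')"
    using assms A.coset_eq_iff[OF E.submod] linear_map.map_minus[OF mult_A_linear_left]
      linear_map.map_minus[OF mult_A_linear_right] mult_A_closed by simp_all
  then show ?thesis by simp
qed

lemma commutator_term_closed: "t \<in> terms \<Longrightarrow> commutator_term G t \<in> carrier G"
  by (induction t) (auto simp: bracket_closed twist_closed)

text \<open>By induction on terms: the relations turn brackets and twists of wedges into wedges.  Hence the
  wedges span the exterior product, although it is generated by them only as an algebra.\<close>

lemma cls_term_is_wedge:
  "t \<in> terms \<Longrightarrow> \<exists>x\<in>carrier G. \<exists>y\<in>carrier G. E.cls (basis_vec K t) = wedge x y"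
proof (induction t)
  case (Wedge x y)
  then show ?case by auto
next
  case (Brk s t)
  then have st: "s \<in> terms" "t \<in> terms" by auto
  from Brk.IH(1)[OF st(1)] obtain x y where s: "x \<in> carrier G" "y \<in> carrier G"
    "E.cls (basis_vec K s) = wedge x y" by blast
  from Brk.IH(2)[OF st(2)] obtain x' y' where t: "x' \<in> carrier G" "y' \<in> carrier G"
    "E.cls (basis_vec K t) = wedge x' y'" by blast
  have "E.cls (basis_vec K (Brk s t)) = E.cls (wedge_sym K x y \<otimes>\<^bsub>A\<^esub> wedge_sym K x' y')"
    unfolding mult_A_basis[OF st, symmetric]
    using A.basis_vec_closed[OF st(1)] A.basis_vec_closed[OF st(2)] s t
    by (intro cls_mult_cong wedge_closed)
  also have "\<dots> = wedge (x \<otimes>\<^bsub>G\<^esub> y) (x' \<otimes>\<^bsub>G\<^esub> y')"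
    using s t by (intro ext_rel_cls_eq ext_rel.bracket refl)
  finally show ?case using s t bracket_closed[OF s(1,2)] bracket_closed[OF t(1,2)]
    by (intro bexI[of _ "x \<otimes>\<^bsub>G\<^esub> y"] bexI[of _ "x' \<otimes>\<^bsub>G\<^esub> y'"]) simp_all
next
  case (Twist t)
  then have t: "t \<in> terms" by auto
  from Twist.IH[OF t] obtain x y where xy: "x \<in> carrier G" "y \<in> carrier G"
    "E.cls (basis_vec K t) = wedge x y" by blast
  have "E.cls (basis_vec K (Twist t)) = wedge (twist G x) (twist G y)"
    unfolding twist_A_basis[OF t, symmetric] using xy
    by (simp add: E.cls_twist A.basis_vec_closed[OF t] wedge.pair_twist)
  then show ?case using xy
    by (intro bexI[of _ "twist G x"] bexI[of _ "twist G y"]) (simp_all add: twist_closed)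
qed

lemma wedge_tensor_map_surj: "wedge.tensor_map ` carrier (T 2) = carrier E.quot"
proof
  show "wedge.tensor_map ` carrier (T 2) \<subseteq> carrier E.quot" using wedge.tensor.map_closed by auto
  have sub: "submodule {a \<in> carrier A. E.cls a \<in> wedge.tensor_map ` carrier (T 2)} K A"
    by (intro E.cls.preimage_submodule wedge.tensor.image_submodule F.carrier_is_submodule)
  have "E.cls (basis_vec K t) \<in> wedge.tensor_map ` carrier (T 2)" if t: "t \<in> terms" for t
  proof -
    obtain x y where xy: "x \<in> carrier G" "y \<in> carrier G" "E.cls (basis_vec K t) = wedge x y"
      using cls_term_is_wedge[OF t] by blast
    moreover have "basis_vec K [x, y] \<in> carrier (T 2)"
      using xy by (intro F.basis_vec_closed) (simp add: pair_gens)
    ultimately show ?thesis using wedge.tensor_map_basis[OF xy(1,2)] by (intro image_eqI) simp_all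
  qed
  then have "carrier A \<subseteq> {a \<in> carrier A. E.cls a \<in> wedge.tensor_map ` carrier (T 2)}"
    using A.basis_vec_closed by (intro A.basis_span[OF sub]) blast
  then show "carrier E.quot \<subseteq> wedge.tensor_map ` carrier (T 2)"
    unfolding E.carrier_quot by blast
qed

end

text \<open>The map on terms induced by a pairing.  Its value on a bracket is forced: in the exterior product
  a bracket equals the wedge of the commutators of its factors.\<close>

primrec pairing_term ::
  "('k, 'a) hom_module \<Rightarrow> ('k, 'b) hom_module \<Rightarrow> ('a \<Rightarrow> 'a \<Rightarrow> 'b) \<Rightarrow> 'a ext_term \<Rightarrow> 'b"
  where
  "pairing_term G W \<tau> (Wedge x y) = \<tau> x y"
| "pairing_term G W \<tau> (Brk s t) = \<tau> (commutator_term G s) (commutator_term G t)"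
| "pairing_term G W \<tau> (Twist t) = twist W (pairing_term G W \<tau> t)"

lemma pairing_term_bracket: "pairing_term G G (mult G) = commutator_term G"
proof
  show "pairing_term G G (mult G) t = commutator_term G t" for t by (induction t) auto
qed

context leibniz
begin

abbreviation "commutator \<equiv> lin_ext K G (commutator_term G)"

lemma commutator_term_funcset: "commutator_term G \<in> terms \<rightarrow> carrier G"
  using commutator_term_closed by auto

sublocale commutator: linear_map K A G commutator
  by (rule A.lin_ext_linear[OF V.module_axioms commutator_term_funcset])

lemma commutator_basis: "t \<in> terms \<Longrightarrow> commutator (basis_vec K t) = commutator_term G t"
  by (rule A.lin_ext_basis[OF V.module_axioms commutator_term_funcset])

end

context leibniz_pairing
begin

abbreviation "ext_map \<equiv> lin_ext K W (pairing_term G W \<tau>)"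

lemma pairing_term_funcset: "pairing_term G W \<tau> \<in> terms \<rightarrow> carrier W"
proof
  show "pairing_term G W \<tau> t \<in> carrier W" if "t \<in> terms" for t
    using that by (induction t) (auto intro!: pair_closed commutator_term_closed W.twist_closed)
qed

sublocale ext: linear_map K A W ext_map
  by (rule A.lin_ext_linear[OF W.V.module_axioms pairing_term_funcset])

lemma ext_map_basis: "t \<in> terms \<Longrightarrow> ext_map (basis_vec K t) = pairing_term G W \<tau> t"
  by (rule A.lin_ext_basis[OF W.V.module_axioms pairing_term_funcset])

lemma ext_map_wedge: "\<lbrakk>x \<in> carrier G; y \<in> carrier G\<rbrakk> \<Longrightarrow> ext_map (wedge_sym K x y) = \<tau> x y"
  using ext_map_basis[of "Wedge x y"] by simp

lemma ext_map_twist: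
  assumes "a \<in> carrier A"
  shows "ext_map (twist A a) = twist W (ext_map a)"
proof (rule A.linear_eqI[OF _ _ _ assms])
  show "linear_map K A W (\<lambda>a. ext_map (twist A a))"
    using twist_A_linear ext.linear_map_axioms by (rule linear_map_comp)
  show "linear_map K A W (\<lambda>a. twist W (ext_map a))"
    using ext.linear_map_axioms W.twist_linear by (rule linear_map_comp)
  show "ext_map (twist A (basis_vec K t)) = twist W (ext_map (basis_vec K t))" if "t \<in> terms" for t
    using that ext_map_basis[of "Twist t"] by (simp add: twist_A_basis ext_map_basis)
qed

lemma ext_map_mult:
  assumes a: "a \<in> carrier A" and b: "b \<in> carrier A"
  shows "ext_map (a \<otimes>\<^bsub>A\<^esub> b) = \<tau> (commutator a) (commutator b)"
proof (rule A.linear_eqI[where f = "\<lambda>a. ext_map (a \<otimes>\<^bsub>A\<^esub> b)" and g = "\<lambda>a. \<tau> (commutator a) (commutator b)", OF _ _ _ a])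
  show "linear_map K A W (\<lambda>a. ext_map (a \<otimes>\<^bsub>A\<^esub> b))"
    using mult_A_linear_left[OF b] ext.linear_map_axioms by (rule linear_map_comp)
  show "linear_map K A W (\<lambda>a. \<tau> (commutator a) (commutator b))"
    using commutator.linear_map_axioms linear_left[OF commutator.map_closed[OF b]] by (rule linear_map_comp)
  fix s assume s: "s \<in> terms"
  show "ext_map (basis_vec K s \<otimes>\<^bsub>A\<^esub> b) = \<tau> (commutator (basis_vec K s)) (commutator b)"
  proof (rule A.linear_eqI[OF _ _ _ b])
    show "linear_map K A W (\<lambda>b. ext_map (basis_vec K s \<otimes>\<^bsub>A\<^esub> b))"
      using mult_A_linear_right[OF A.basis_vec_closed[OF s]] ext.linear_map_axioms by (rule linear_map_comp)
    show "linear_map K A W (\<lambda>b. \<tau> (commutator (basis_vec K s)) (commutator b))"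
      using commutator.linear_map_axioms linear_right[OF commutator.map_closed[OF A.basis_vec_closed[OF s]]]
      by (rule linear_map_comp)
    show "ext_map (basis_vec K s \<otimes>\<^bsub>A\<^esub> basis_vec K t) = \<tau> (commutator (basis_vec K s)) (commutator (basis_vec K t))"
      if "t \<in> terms" for t
      using s that ext_map_basis[of "Brk s t"] by (simp add: mult_A_basis commutator_basis)
  qed
qed

end

context leibniz
begin

lemma commutator_eq_ext_map: "commutator = bracket.ext_map"
  by (simp add: pairing_term_bracket)

lemma commutator_mult: "\<lbrakk>a \<in> carrier A; b \<in> carrier A\<rbrakk> \<Longrightarrow> commutator (a \<otimes>\<^bsub>A\<^esub> b) = commutator a \<otimes>\<^bsub>G\<^esub> commutator b"
  using bracket.ext_map_mult unfolding commutator_eq_ext_map .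

lemma commutator_twist: "a \<in> carrier A \<Longrightarrow> commutator (twist A a) = twist G (commutator a)"
  using bracket.ext_map_twist unfolding commutator_eq_ext_map .

lemma commutator_wedge: "\<lbrakk>x \<in> carrier G; y \<in> carrier G\<rbrakk> \<Longrightarrow> commutator (wedge_sym K x y) = x \<otimes>\<^bsub>G\<^esub> y"
  using commutator_basis[of "Wedge x y"] by simp

end

context leibniz_pairing
begin

text \<open>The Hom-Leibniz law between brackets and the three relations between wedges that involve the
  bracket of \<open>G\<close> become instances of the identity of the pairing, the former at commutators.\<close>

lemma ext_map_respects_rel:
  assumes "ext_rel K G l r"
  shows "ext_map l = ext_map r"
proof -
  note simps = ext_map_mult ext_map_twist ext_map_wedge commutator_mult commutator_twist commutator_wedge
    ext.map_add ext.map_smult ext.map_minus ext.map_a_inv mult_A_closed 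
    linear_map.map_closed[OF twist_A_linear] wedge_closed commutator.map_closed
    bracket_closed twist_closed pair_add_left pair_add_right pair_smult_left pair_smult_right pair_twist
  show ?thesis
    using assms
  proof cases
    case (leibniz A u v w)
    then show ?thesis by (simp add: simps pair_leibniz)
  next
    case (multiplicative A u v)
    then show ?thesis by (simp add: simps)
  next
    case (add_left A x y z)
    then show ?thesis by (simp add: simps)
  next
    case (add_right A x y z)
    then show ?thesis by (simp add: simps)
  next
    case (smult_left A c x y)
    then show ?thesis by (simp add: simps)
  next
    case (smult_right A c x y)
    then show ?thesis by (simp add: simps)
  next
    case (alternating A x y z)
    then show ?thesis using pair_alternating[OF alternating(4-6)] by (simp add: simps)
  next
    case (wedge_bracket A x y z)
    then show ?thesis using pair_leibniz[OF wedge_bracket(4-6)] by (simp add: simps)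
  next
    case (bracket_wedge A x y z)
    then show ?thesis using pair_bracket_left[OF bracket_wedge(4-6)] by (simp add: simps)
  next
    case (bracket A x y x' y')
    then show ?thesis by (simp add: simps)
  next
    case (twist_wedge A x y)
    then show ?thesis by (simp add: simps)
  qed
qed

text \<open>The kernel of \<open>ext_map\<close> alone is not visibly an ideal; cutting it with the kernel of the
  commutator makes it one, because \<open>ext_map\<close> sees a product only through the commutators of its
  factors.\<close>

lemma ext_map_ideal:
  assumes "a \<in> I"
  shows "ext_map a = \<zero>\<^bsub>W\<^esub>" "commutator a = \<zero>\<^bsub>G\<^esub>"
proof -
  let ?J = "{a \<in> carrier A. ext_map a \<in> {\<zero>\<^bsub>W\<^esub>}} \<inter> {a \<in> carrier A. commutator a \<in> {\<zero>\<^bsub>G\<^esub>}}"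
  have "submodule (\<Inter>{{a \<in> carrier A. ext_map a \<in> {\<zero>\<^bsub>W\<^esub>}}, {a \<in> carrier A. commutator a \<in> {\<zero>\<^bsub>G\<^esub>}}}) K A"
    using ext.preimage_submodule[OF W.V.singleton_zero_submodule]
      commutator.preimage_submodule[OF V.singleton_zero_submodule]
    by (intro module.Inter_submodule[OF A_module]) auto
  then have "hom_ideal K A ?J"
    unfolding hom_ideal_def
    by (auto simp: ext_map_mult commutator_mult ext_map_twist commutator_twist mult_A_closed
        linear_map.map_closed[OF twist_A_linear] pair_zero_left pair_zero_right commutator.map_closed
        bracket.pair_zero_left bracket.pair_zero_right
        linear_map.map_zero[OF twist_linear] linear_map.map_zero[OF W.twist_linear])
  moreover have "l \<ominus>\<^bsub>A\<^esub> r \<in> ?J" if "ext_rel K G l r" for l r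
    using ext_rel_closed[OF that] ext_map_respects_rel[OF that]
      leibniz_pairing.ext_map_respects_rel[OF bracket_pairing that, folded commutator_eq_ext_map]
    by (simp add: ext.map_minus commutator.map_minus ext.map_closed commutator.map_closed
        W.V.minus_eq_zero_iff V.minus_eq_zero_iff)
  ultimately have "I \<subseteq> ?J" unfolding ext_ideal_def by (intro hull_minimal) auto
  then show "ext_map a = \<zero>\<^bsub>W\<^esub>" "commutator a = \<zero>\<^bsub>G\<^esub>" using assms by auto
qed

text \<open>Combinations of lists \<open>[x, y]\<close> map to the free algebra by \<open>[x, y] \<mapsto> Wedge x y\<close>; composing with
  \<open>E.cls\<close> gives the wedge map and composing with \<open>ext_map\<close> gives \<open>tensor_map\<close>.  So a combination
  killed by the former lies in the ideal after this substitution, and is killed by the latter.\<close>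

lemma tensor_map_factors:
  assumes f: "f \<in> carrier (T 2)" and "wedge.tensor_map f = \<zero>\<^bsub>E.quot\<^esub>"
  shows "tensor_map f = \<zero>\<^bsub>W\<^esub>"
proof -
  let ?\<phi> = "lin_ext K A (\<lambda>xs. wedge_sym K (hd xs) (last xs))"
  have gen: "(\<lambda>xs. wedge_sym K (hd xs) (last xs)) \<in> tensor_gens G 2 \<rightarrow> carrier A"
    by (auto elim!: gens_2E intro: wedge_closed)
  interpret \<phi>: linear_map K "T 2" A ?\<phi> by (rule F.lin_ext_linear[OF A_module gen])
  have basis: "?\<phi> (basis_vec K [x, y]) = wedge_sym K x y" if "x \<in> carrier G" "y \<in> carrier G" for x y
    using F.lin_ext_basis[OF A_module gen, of "[x, y]"] that by (simp add: pair_gens)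
  have "wedge.tensor_map f = E.cls (?\<phi> f)"
  proof (rule F.linear_eqI[OF wedge.tensor.linear_map_axioms _ _ f])
    show "linear_map K (T 2) E.quot (\<lambda>f. E.cls (?\<phi> f))"
      using \<phi>.linear_map_axioms E.cls.linear_map_axioms by (rule linear_map_comp)
  qed (auto elim!: gens_2E simp: wedge.tensor_map_basis basis)
  then have "?\<phi> f \<in> I"
    using assms(2) E.cls_eq_zero_iff[OF \<phi>.map_closed[OF f]] by metis
  then have "ext_map (?\<phi> f) = \<zero>\<^bsub>W\<^esub>" by (rule ext_map_ideal)
  moreover have "tensor_map f = ext_map (?\<phi> f)"
  proof (rule F.linear_eqI[OF tensor.linear_map_axioms _ _ f])
    show "linear_map K (T 2) W (\<lambda>f. ext_map (?\<phi> f))"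
      using \<phi>.linear_map_axioms ext.linear_map_axioms by (rule linear_map_comp)
  qed (auto elim!: gens_2E simp: tensor_map_basis basis ext_map_wedge)
  ultimately show ?thesis by simp
qed

end

section \<open>The isomorphism\<close>

context leibniz
begin

lemma commutator_map_cls:
  assumes "a \<in> carrier A"
  shows "commutator_map K G (E.cls a) = commutator a"
proof -
  have "commutator b = commutator a" if "b \<in> E.cls a" for b
  proof -
    have b: "b \<in> carrier A" "b \<ominus>\<^bsub>A\<^esub> a \<in> I"
      using that module.mem_coset_iff[OF A_module E.submod assms] module.coset_eq_iff[OF A_module E.submod _ assms] by auto
    then have "commutator (b \<ominus>\<^bsub>A\<^esub> a) = \<zero>\<^bsub>G\<^esub>" using bracket.ext_map_ideal(2) by simp
    then show ?thesis
      using b assms by (simp add: commutator.map_minus commutator.map_closed V.minus_eq_zero_iff)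
  qed
  moreover have "a \<in> E.cls a"
    using assms by (intro module.mem_coset_iff[OF A_module E.submod assms, THEN iffD2] conjI refl)
  ultimately have "commutator ` E.cls a = {commutator a}" by blast
  then show ?thesis by (simp add: commutator_map_def)
qed

lemma commutator_map_linear: "linear_map K E.quot G (commutator_map K G)"
proof (rule linear_mapI[OF E.quot.V.module_axioms V.module_axioms])
  have rep: "\<exists>a\<in>carrier A. X = E.cls a" if "X \<in> carrier E.quot" for X
    using that unfolding E.carrier_quot by blast
  fix X Y assume "X \<in> carrier E.quot" "Y \<in> carrier E.quot"
  then obtain a b where ab: "a \<in> carrier A" "b \<in> carrier A" "X = E.cls a" "Y = E.cls b"
    using rep by metis
  show "commutator_map K G X \<in> carrier G"
    unfolding ab(3) commutator_map_cls[OF ab(1)] using ab(1) by (rule commutator.map_closed)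
  show "commutator_map K G (X \<oplus>\<^bsub>E.quot\<^esub> Y) = commutator_map K G X \<oplus>\<^bsub>G\<^esub> commutator_map K G Y"
    unfolding ab(3,4) E.cls_add[OF ab(1,2), symmetric] commutator_map_cls[OF ab(1)]
      commutator_map_cls[OF ab(2)] commutator_map_cls[OF A.add_mem[OF ab(1,2)]]
    using ab(1,2) by (rule commutator.map_add)
next
  fix c X assume c: "c \<in> carrier K" and "X \<in> carrier E.quot"
  then obtain a where a: "a \<in> carrier A" "X = E.cls a"
    unfolding E.carrier_quot by blast
  show "commutator_map K G (c \<odot>\<^bsub>E.quot\<^esub> X) = c \<odot>\<^bsub>G\<^esub> commutator_map K G X"
    unfolding a(2) E.cls_smult[OF c a(1), symmetric] commutator_map_cls[OF a(1)]
      commutator_map_cls[OF A.smult_mem[OF c a(1)]]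
    using c a(1) by (rule commutator.map_smult)
qed

lemma commutator_map_tensor:
  assumes "f \<in> carrier (T 2)"
  shows "commutator_map K G (wedge.tensor_map f) = bracket.tensor_map f"
proof (rule F.linear_eqI[OF _ bracket.tensor.linear_map_axioms _ assms])
  show "linear_map K (T 2) G (\<lambda>f. commutator_map K G (wedge.tensor_map f))"
    using wedge.tensor.linear_map_axioms commutator_map_linear by (rule linear_map_comp)
qed (auto elim!: gens_2E simp: wedge.tensor_map_basis bracket.tensor_map_basis commutator_map_cls
      wedge_closed commutator_wedge)

text \<open>Each of the two maps comes from a Leibniz pairing into its target, and the target of the other
  one is universal for such pairings; hence each map kills what the other kills.\<close>

lemma wedge_zero_iff_boundary:
  assumes f: "f \<in> carrier (T 2)"
  shows "tensor_cls f = \<zero>\<^bsub>Q.quot\<^esub> \<longleftrightarrow> wedge.tensor_map f = \<zero>\<^bsub>E.quot\<^esub>"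
proof
  interpret q: leibniz_pairing K G Q.quot "\<lambda>x y. tensor_cls (basis_vec K [x, y])"
    by (rule tensor_cls_pairing)
  have eq: "tensor_cls f = q.tensor_map f"
    using tensor_cls_linear q.tensor.linear_map_axioms _ f
    by (rule F.linear_eqI) (auto elim!: gens_2E simp: q.tensor_map_basis)
  assume "wedge.tensor_map f = \<zero>\<^bsub>E.quot\<^esub>"
  then show "tensor_cls f = \<zero>\<^bsub>Q.quot\<^esub>" unfolding eq by (rule q.tensor_map_factors[OF f])
next
  assume "tensor_cls f = \<zero>\<^bsub>Q.quot\<^esub>"
  then have "N 2 +>\<^bsub>T 2\<^esub> f \<in> boundaries"
    using Q.cls_eq_zero_iff C.cls.map_closed[OF f] unfolding CL_eq by blast
  then obtain g where g: "g \<in> carrier (T 3)" "N 2 +>\<^bsub>T 2\<^esub> f = N 2 +>\<^bsub>T 2\<^esub> D 3 g"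
    unfolding boundaries_eq by blast
  have Dg: "D 3 g \<in> carrier (T 2)" using linear_map.map_closed[OF D_linear(2) g(1)] .
  have "f \<ominus>\<^bsub>T 2\<^esub> D 3 g \<in> N 2" using g(2) F.coset_eq_iff[OF tensor_ker_submodule f Dg] by simp
  from wedge.tensor_map_ker[OF this] show "wedge.tensor_map f = \<zero>\<^bsub>E.quot\<^esub>"
    using f Dg wedge.tensor_map_boundary[OF g(1)]
    by (simp add: wedge.tensor.map_minus wedge.tensor.map_closed E.quot.V.minus_eq_zero_iff)
qed

text \<open>The common cover is the space of the combinations of lists \<open>[x, y]\<close> whose commutator vanishes:
  modulo multilinearity these are the cycles, and their wedges form the kernel of the commutator map.\<close>

lemma HL_2_isomorphic_ker_commutator:
  "hom_vs_isomorphic K (HL K G 2) (hom_vs_ker (exterior_product K G) G (commutator_map K G))"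
proof -
  let ?ker = "{f \<in> carrier (T 2). bracket.tensor_map f = \<zero>\<^bsub>G\<^esub>}"
  let ?Z = "T 2\<lparr>carrier := ?ker\<rparr>"
  have sub: "submodule ?ker K (T 2)"
    using bracket.tensor.preimage_submodule[OF V.singleton_zero_submodule] by simp
  have Z: "hom_vector_space K ?Z"
  proof (intro hom_vector_space.intro hom_vector_space_axioms.intro K.field_axioms)
    show "module K ?Z" using submodule.submodule_is_module[OF sub F.module_axioms] .
  qed (use linear_map.map_closed[OF twist_tensor_linear] linear_map.map_add[OF twist_tensor_linear]
      linear_map.map_smult[OF twist_tensor_linear] linear_map.map_zero[OF twist_linear]
      in \<open>auto simp: bracket.tensor_map_twist\<close>)
  interpret q: linear_map K "T 2" Q.quot tensor_cls by (rule tensor_cls_linear)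
  have ker_d2: "carrier (hom_vs_ker (CL K G 2) (CL K G 1) (boundary K G 2))
      = (\<lambda>f. N 2 +>\<^bsub>T 2\<^esub> f) ` ?ker"
  proof -
    have "boundary K G 2 (N 2 +>\<^bsub>T 2\<^esub> f) = \<zero>\<^bsub>CL K G 1\<^esub> \<longleftrightarrow> bracket.tensor_map f = \<zero>\<^bsub>G\<^esub>"
      if "f \<in> carrier (T 2)" for f
      using C.cls_eq_zero_iff linear_map.map_closed[OF D_linear(1) that] D_2_mem_ker_iff[OF that]
      unfolding boundary_2_cls[OF that] CL_eq by simp
    then show ?thesis
      unfolding hom_vs_ker_def a_kernel_def kernel_def CL_eq C.carrier_quot by auto
  qed
  \<comment> \<open>Restricting the carrier to the cycles changes neither cosets nor operations.\<close>
  have HL_ops: "add (HL K G 2) = add Q.quot" "zero (HL K G 2) = zero Q.quot"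
    "smult (HL K G 2) = smult Q.quot" "twist (HL K G 2) = twist Q.quot"
    by (simp_all add: HL_def quot_hom_module_def hom_vs_ker_def set_add_def set_mult_def
        quot_map_def a_r_coset_def r_coset_def fun_eq_iff)
  have HL_carrier: "carrier (HL K G 2) = tensor_cls ` ?ker"
    using ker_d2
    by (auto simp: HL_def quot_hom_module_def hom_vs_ker_def A_RCOSETS_def' a_r_coset_def r_coset_def)
  have f: "tensor_cls \<in> hom_vs_hom K ?Z (HL K G 2)"
    unfolding hom_vs_hom_def HL_ops HL_carrier
    by (auto simp: q.map_add q.map_smult tensor_cls_twist)
  have g: "wedge.tensor_map \<in> hom_vs_hom K ?Z (hom_vs_ker (exterior_product K G) G (commutator_map K G))"
    unfolding hom_vs_hom_def exterior_product_eq
    by (auto simp: hom_vs_ker_def a_kernel_def kernel_def wedge.tensor.map_add wedge.tensor.map_smult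
        wedge.tensor.map_closed wedge.tensor_map_twist commutator_map_tensor)
  have g_surj: "wedge.tensor_map ` ?ker = carrier (hom_vs_ker (exterior_product K G) G (commutator_map K G))"
    unfolding hom_vs_ker_def a_kernel_def kernel_def exterior_product_eq
    by (auto simp: commutator_map_tensor wedge_tensor_map_surj[symmetric])
  show ?thesis
  proof (rule hom_vs_isomorphic_of_common_cover[OF Z f g])
    show "tensor_cls z = \<zero>\<^bsub>HL K G 2\<^esub>
        \<longleftrightarrow> wedge.tensor_map z = \<zero>\<^bsub>hom_vs_ker (exterior_product K G) G (commutator_map K G)\<^esub>"
      if "z \<in> carrier ?Z" for z
      using wedge_zero_iff_boundary[of z] that by (simp add: HL_ops hom_vs_ker_def exterior_product_eq)
  qed (use HL_carrier g_surj q.map_zero wedge.tensor.map_zero in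
      \<open>simp_all add: HL_ops hom_vs_ker_def exterior_product_eq\<close>)
qed

end

theorem theorem4p1:
  fixes K :: "('k, 'r) ring_scheme" and G :: "('k, 'a) hom_module"
  assumes "field K"
    and "hom_leibniz_algebra K G"
  shows "hom_vs_isomorphic K (HL K G 2)
    (hom_vs_ker (exterior_product K G) G (commutator_map K G))"
  using leibniz.HL_2_isomorphic_ker_commutator[OF leibniz.intro[OF assms(2)]] .

end
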